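(* Let $n\ge2$. There exists a $C^\infty$ function on a neighborhood of the closed unit ball $\overline{\mathbf{B}}$ of $\mathbf{R}^n$ that is real-analytic in a neighborhood of $\partial\mathbf{B}$ and whose best harmonic approximant in $L^1(\mathbf{B})$ is unbounded on $\mathbf{B}$.
   Context: $\mathbf{B}$ is the open unit ball in $\mathbf{R}^n$ with Lebesgue measure. $L^1_h(\mathbf{B})$ is the space of integrable harmonic functions on $\mathbf{B}$. A best harmonic approximant in $L^1(\mathbf{B})$ to $\omega\in L^1(\mathbf{B})$ is an $h\in L^1_h(\mathbf{B})$ minimizing $\|\omega-h\|_1$ over $L^1_h(\mathbf{B})$. *)

theory Defs
  imports "HOL-Analysis.Analysis"
begin

text \<open>The predicates \<open>Ck_on\<close>, \<open>smooth_on\<close>, \<open>real_analytic_on\<close> and \<open>harmonic_on\<close> below are meant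
  for open sets; there they depend only on the values of the function on the set.\<close>

abbreviation dir_deriv :: "real^'n \<Rightarrow> (real^'n \<Rightarrow> real) \<Rightarrow> real^'n \<Rightarrow> real"
  where "dir_deriv v f \<equiv> (\<lambda>x. frechet_derivative f (at x) v)"

primrec Ck_on :: "nat \<Rightarrow> (real^'n) set \<Rightarrow> (real^'n \<Rightarrow> real) \<Rightarrow> bool" where
  "Ck_on 0 S f \<longleftrightarrow> continuous_on S f"
| "Ck_on (Suc k) S f \<longleftrightarrow>
     (\<forall>x\<in>S. f differentiable (at x)) \<and> (\<forall>v. Ck_on k S (dir_deriv v f))"

definition smooth_on :: "(real^'n) set \<Rightarrow> (real^'n \<Rightarrow> real) \<Rightarrow> bool"
  where "smooth_on S f \<longleftrightarrow> (\<forall>k. Ck_on k S f)"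

text \<open>Near each point \<open>x\<close> the function is the sum of a power series in \<open>y - x\<close>, indexed by
  multi-indices \<open>\<alpha> :: 'n \<Rightarrow> nat\<close>; \<open>has_sum\<close> is unconditional (for reals: absolute)
  convergence.\<close>

definition real_analytic_on :: "(real^'n) set \<Rightarrow> (real^'n \<Rightarrow> real) \<Rightarrow> bool"
  where "real_analytic_on S f \<longleftrightarrow>
    (\<forall>x\<in>S. \<exists>r>0. \<exists>a :: ('n \<Rightarrow> nat) \<Rightarrow> real. \<forall>y\<in>ball x r.
       ((\<lambda>\<alpha>. a \<alpha> * (\<Prod>i\<in>UNIV. (y $ i - x $ i) ^ \<alpha> i)) has_sum f y) UNIV)"

definition laplacian :: "(real^'n \<Rightarrow> real) \<Rightarrow> real^'n \<Rightarrow> real"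
  where "laplacian f x = (\<Sum>i\<in>UNIV. dir_deriv (axis i 1) (dir_deriv (axis i 1) f) x)"

definition harmonic_on :: "(real^'n) set \<Rightarrow> (real^'n \<Rightarrow> real) \<Rightarrow> bool"
  where "harmonic_on S f \<longleftrightarrow> Ck_on 2 S f \<and> (\<forall>x\<in>S. laplacian f x = 0)"

definition L1h_ball :: "(real^'n \<Rightarrow> real) set"
  where "L1h_ball = {h. harmonic_on (ball 0 1) h \<and> h absolutely_integrable_on ball 0 1}"

definition L1_norm_ball :: "(real^'n \<Rightarrow> real) \<Rightarrow> real"
  where "L1_norm_ball f = (LINT x:ball 0 1|lebesgue. \<bar>f x\<bar>)"

definition best_harmonic_approximant :: "(real^'n \<Rightarrow> real) \<Rightarrow> (real^'n \<Rightarrow> real) \<Rightarrow> bool"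
  where "best_harmonic_approximant \<omega> h \<longleftrightarrow>
    \<omega> absolutely_integrable_on ball 0 1 \<and> h \<in> L1h_ball \<and>
    (\<forall>g\<in>L1h_ball. L1_norm_ball (\<lambda>x. \<omega> x - h x) \<le> L1_norm_ball (\<lambda>x. \<omega> x - g x))"

end

theory Submission
  imports Defs "HOL-Computational_Algebra.Polynomial"
begin

text \<open>For \<open>\<rho>\<^sup>n = 1/2\<close> the function that is \<open>1\<close> on \<open>\<bar>x\<bar> < \<rho>\<close> and \<open>-1\<close> on \<open>\<rho> < \<bar>x\<bar> < 1\<close> annihilates
  \<open>L\<^sup>1\<^sub>h\<close> by the mean value property, so \<open>h\<close> is a best approximant of \<open>\<omega>\<close> as soon as
  \<open>\<omega> - h\<close> has this sign pattern. Take for \<open>h\<close> a positive harmonic function with a pole on the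
  sphere and \<open>\<omega> = \<phi>(\<bar>x\<bar>\<^sup>2) h\<close> with \<open>\<phi>\<close> smooth and decreasing, \<open>\<phi>(\<rho>\<^sup>2) = 1\<close>, and \<open>\<phi> = 0\<close> near
  \<open>1\<close>. Any other best approximant has the same sign pattern, so it agrees with \<open>h\<close> on the sphere of
  radius \<open>\<rho>\<close>, hence inside it, hence on the unit ball by unique continuation.\<close>

text \<open>No surface integrals occur. The divergence theorem is used only for fields that vanish
  on the bounding sphere, where it says that a volume integral is zero; a factor
  \<open>1 - |x|^2\<close>, or a factor \<open>u\<close> that is zero on the sphere, produces such
  fields. One identity about integrals of \<open>u (a x) v (b x)\<close> serves twice: with
  \<open>v = 1\<close> it is the mean value property, with \<open>u = v\<close> it is a quantitative
  form of unique continuation. In the example, \<open>h\<close> has to be unbounded and still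
  integrable, and \<open>\<omega>\<close> has to be smooth where \<open>h\<close> is singular.
  Positivity settles the first point, since the mean value property then bounds the integrals over
  smaller balls; it also reduces the comparison of \<open>\<omega>\<close> with \<open>h\<close> to
  that of the cutoff with 1. Vanishing of \<open>\<omega>\<close> near the sphere settles the second
  point and makes analyticity there trivial. The pole needs a second coordinate: for
  \<open>n = 1\<close> harmonic functions are affine. The radius \<open>\<rho>\<close> is forced by
  testing the sign function against constants: the inner ball and the shell around it must have
  equal volume.\<close>

section \<open>Calculus of \<open>C\<^sup>k\<close> functions\<close>

lemma dir_deriv_eq: "(f has_derivative f') (at x) \<Longrightarrow> dir_deriv v f x = f' v"
  using frechet_derivative_at by metis

lemma has_derivative_dir_deriv:
  "f differentiable (at x) \<Longrightarrow> (f has_derivative (\<lambda>v. dir_deriv v f x)) (at x)"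
  using frechet_derivative_works by (metis eta_contract_eq)

lemma dir_deriv_cong:
  assumes "open S" "x \<in> S" "\<And>y. y \<in> S \<Longrightarrow> f y = g y" "f differentiable (at x)"
  shows "dir_deriv v f x = dir_deriv v g x"
  using frechet_derivative_transform_within_open[OF assms(4,1,2,3)] by simp

lemma dir_deriv_const [simp]: "dir_deriv v (\<lambda>_. c) x = 0"
  by (rule dir_deriv_eq[OF has_derivative_const])

lemma has_derivative_vec_nth': "((\<lambda>x::real^'n. x $ i) has_derivative (\<lambda>v. v $ i)) (at x)"
  by (rule bounded_linear_imp_has_derivative[OF bounded_linear_vec_nth])

lemma dir_deriv_vec_nth [simp]: "dir_deriv v (\<lambda>x. x $ i) x = v $ i"
  by (rule dir_deriv_eq[OF has_derivative_vec_nth'])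

lemma dir_deriv_add:
  assumes "f differentiable (at x)" "g differentiable (at x)"
  shows "dir_deriv v (\<lambda>x. f x + g x) x = dir_deriv v f x + dir_deriv v g x"
  by (rule dir_deriv_eq[OF has_derivative_add[OF assms[THEN has_derivative_dir_deriv]]])

lemma dir_deriv_diff:
  assumes "f differentiable (at x)" "g differentiable (at x)"
  shows "dir_deriv v (\<lambda>x. f x - g x) x = dir_deriv v f x - dir_deriv v g x"
  by (rule dir_deriv_eq[OF has_derivative_diff[OF assms[THEN has_derivative_dir_deriv]]])

lemma dir_deriv_mult:
  assumes "f differentiable (at x)" "g differentiable (at x)"
  shows "dir_deriv v (\<lambda>x. f x * g x) x = f x * dir_deriv v g x + dir_deriv v f x * g x"
  by (rule dir_deriv_eq[OF has_derivative_mult[OF assms[THEN has_derivative_dir_deriv]]])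

lemma dir_deriv_inverse:
  assumes "f differentiable (at x)" "f x \<noteq> 0"
  shows "dir_deriv v (\<lambda>x. inverse (f x)) x = - (inverse (f x) * dir_deriv v f x * inverse (f x))"
  by (rule dir_deriv_eq[OF Deriv.has_derivative_inverse[OF assms(2) has_derivative_dir_deriv[OF assms(1)]]])

lemma dir_deriv_compose_real:
  assumes "f differentiable (at x)" "(g has_real_derivative g') (at (f x))"
  shows "dir_deriv v (\<lambda>x. g (f x)) x = g' * dir_deriv v f x"
  by (rule dir_deriv_eq[OF has_derivative_compose[OF has_derivative_dir_deriv[OF assms(1)]
        assms(2)[unfolded has_field_derivative_def]]])

lemma has_derivative_scaleR_arg: "((\<lambda>x::real^'n. a *\<^sub>R x) has_derivative (\<lambda>v. a *\<^sub>R v)) (at x)"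
  by (rule bounded_linear_imp_has_derivative[OF bounded_linear_scaleR_right])

lemma dir_deriv_scaleR:
  fixes f :: "real^'n \<Rightarrow> real"
  assumes "f differentiable (at (a *\<^sub>R x))"
  shows "dir_deriv v (\<lambda>x. f (a *\<^sub>R x)) x = a * dir_deriv v f (a *\<^sub>R x)"
proof -
  have D: "(f has_derivative (\<lambda>v. dir_deriv v f (a *\<^sub>R x))) (at (a *\<^sub>R x))"
    by (rule has_derivative_dir_deriv[OF assms])
  have "dir_deriv v (\<lambda>x. f (a *\<^sub>R x)) x = dir_deriv (a *\<^sub>R v) f (a *\<^sub>R x)"
    by (rule dir_deriv_eq[OF has_derivative_compose[OF has_derivative_scaleR_arg D]])
  also have "\<dots> = a * dir_deriv v f (a *\<^sub>R x)"
    using linear_cmul[OF has_derivative_linear[OF D], of a v] by simp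
  finally show ?thesis .
qed

lemma dir_deriv_axis_sum:
  fixes f :: "real^'n \<Rightarrow> real"
  assumes "f differentiable (at x)"
  shows "dir_deriv v f x = (\<Sum>i\<in>UNIV. v $ i * dir_deriv (axis i 1) f x)"
proof -
  have L: "linear (\<lambda>v. dir_deriv v f x)"
    by (rule has_derivative_linear[OF has_derivative_dir_deriv[OF assms]])
  have "dir_deriv v f x = dir_deriv (\<Sum>i\<in>UNIV. v $ i *\<^sub>R axis i 1) f x"
    using basis_expansion[of v] by (simp add: scalar_mult_eq_scaleR)
  also have "\<dots> = (\<Sum>i\<in>UNIV. v $ i * dir_deriv (axis i 1) f x)"
    by (simp add: linear_sum[OF L] linear_cmul[OF L])
  finally show ?thesis .
qed

text \<open>The rules for \<open>dir_deriv\<close> hold only at points of differentiability, so the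
  derivative of a composite function is known by its formula only on \<open>S\<close>. The closure
  proofs below pass through this congruence to replace the derivative by that formula.\<close>

lemma Ck_on_cong:
  assumes "open S" "\<And>x. x \<in> S \<Longrightarrow> f x = g x" "Ck_on k S f"
  shows "Ck_on k S g"
  using assms(2,3)
proof (induction k arbitrary: f g)
  case 0
  then show ?case by (simp cong: continuous_on_cong)
next
  case (Suc k)
  have d: "f differentiable (at x)" if "x \<in> S" for x
    using Suc.prems that by simp
  have "g differentiable (at x)" if "x \<in> S" for x
    using d[OF that] Suc.prems(1) assms(1) that
    by (meson differentiable_def has_derivative_transform_within_open)
  moreover have "Ck_on k S (dir_deriv v g)" for v
    by (rule Suc.IH[of "dir_deriv v f"])
      (use Suc.prems d dir_deriv_cong[OF assms(1)] in auto)
  ultimately show ?case by simp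
qed

lemma Ck_on_subset: "Ck_on k S f \<Longrightarrow> T \<subseteq> S \<Longrightarrow> Ck_on k T f"
  by (induction k arbitrary: f) (auto intro: continuous_on_subset)

lemma Ck_on_SucD: "Ck_on (Suc k) S f \<Longrightarrow> Ck_on k S f"
proof (induction k arbitrary: f)
  case 0
  then show ?case
    by (auto intro!: continuous_at_imp_continuous_on differentiable_imp_continuous_within)
qed simp

lemma Ck_on_imp_continuous: "Ck_on k S f \<Longrightarrow> continuous_on S f"
  by (induction k) (auto dest: Ck_on_SucD simp del: Ck_on.simps(2))

lemma Ck_on_const: "Ck_on k S (\<lambda>_. c)"
  by (induction k arbitrary: c) auto

lemma Ck_on_vec_nth: "Ck_on k S (\<lambda>x. x $ i)"
  by (cases k) (auto intro!: Ck_on_const continuous_intros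
     bounded_linear_imp_differentiable bounded_linear_vec_nth)

lemma Ck_on_add:
  assumes "open S" "Ck_on k S f" "Ck_on k S g"
  shows "Ck_on k S (\<lambda>x. f x + g x)"
  using assms(2,3)
proof (induction k arbitrary: f g)
  case (Suc k)
  have "Ck_on k S (dir_deriv v (\<lambda>x. f x + g x))" for v
    by (rule Ck_on_cong[OF assms(1) _ Suc.IH[of "dir_deriv v f" "dir_deriv v g"]])
      (use Suc.prems in \<open>auto simp: dir_deriv_add\<close>)
  with Suc.prems show ?case by simp
qed (auto intro: continuous_on_add)

lemma Ck_on_mult:
  assumes "open S" "Ck_on k S f" "Ck_on k S g"
  shows "Ck_on k S (\<lambda>x. f x * g x)"
  using assms(2,3)
proof (induction k arbitrary: f g)
  case (Suc k)
  have "Ck_on k S (dir_deriv v (\<lambda>x. f x * g x))" for v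
    by (rule Ck_on_cong[OF assms(1) _
          Ck_on_add[OF assms(1) Suc.IH[of f "dir_deriv v g"] Suc.IH[of "dir_deriv v f" g]]])
      (use Suc.prems Suc.prems[THEN Ck_on_SucD] in \<open>auto simp: dir_deriv_mult\<close>)
  with Suc.prems show ?case by simp
qed (auto intro: continuous_on_mult)

lemma Ck_on_diff:
  assumes "open S" "Ck_on k S f" "Ck_on k S g"
  shows "Ck_on k S (\<lambda>x. f x - g x)"
  using Ck_on_add[OF assms(1,2) Ck_on_mult[OF assms(1) Ck_on_const assms(3)], of "-1"] by simp

lemma Ck_on_sum:
  assumes "open S" "\<And>i. i \<in> I \<Longrightarrow> Ck_on k S (f i)"
  shows "Ck_on k S (\<lambda>x. \<Sum>i\<in>I. f i x)"
  using assms(2)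
  by (induction I rule: infinite_finite_induct) (auto intro: Ck_on_const Ck_on_add[OF assms(1)])

lemma Ck_on_inverse:
  assumes "open S" "Ck_on k S f" "\<And>x. x \<in> S \<Longrightarrow> f x \<noteq> 0"
  shows "Ck_on k S (\<lambda>x. inverse (f x))"
  using assms(2)
proof (induction k)
  case 0
  with assms(3) show ?case by (auto intro: continuous_on_inverse)
next
  case (Suc k)
  note I = Suc.IH[OF Ck_on_SucD[OF Suc.prems]]
  have "Ck_on k S (dir_deriv v (\<lambda>x. inverse (f x)))" for v
    by (rule Ck_on_cong[OF assms(1) _ Ck_on_diff[OF assms(1) Ck_on_const[of _ _ 0]
          Ck_on_mult[OF assms(1) Ck_on_mult[OF assms(1) I, of "dir_deriv v f"] I]]])
      (use Suc.prems assms(3) in \<open>auto simp: dir_deriv_inverse\<close>)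
  with Suc.prems assms(3) show ?case by (auto intro: differentiable_inverse)
qed

lemma Ck_on_scaleR:
  fixes f :: "real^'n \<Rightarrow> real"
  assumes "open T" "Ck_on k S f" "\<And>x. x \<in> T \<Longrightarrow> a *\<^sub>R x \<in> S"
  shows "Ck_on k T (\<lambda>x. f (a *\<^sub>R x))"
  using assms(2)
proof (induction k arbitrary: f)
  case 0
  then show ?case
    using assms(3) by (auto intro!: continuous_on_compose2[of S f] continuous_intros)
next
  case (Suc k)
  have d: "f differentiable (at (a *\<^sub>R x))" if "x \<in> T" for x
    using Suc.prems assms(3) that by simp
  have "(\<lambda>x. f (a *\<^sub>R x)) differentiable (at x)" if "x \<in> T" for x
    by (rule differentiableI[OF has_derivative_compose[OF has_derivative_scaleR_arg
             has_derivative_dir_deriv[OF d[OF that]]]])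
  moreover have "Ck_on k T (dir_deriv v (\<lambda>x. f (a *\<^sub>R x)))" for v
    by (rule Ck_on_cong[OF assms(1) _ Ck_on_mult[OF assms(1) Ck_on_const[of _ _ a]
          Suc.IH[of "dir_deriv v f"]]])
      (use Suc.prems d in \<open>auto simp: dir_deriv_scaleR\<close>)
  ultimately show ?case by simp
qed

lemma Ck_on_Un:
  assumes "open S" "open T" "Ck_on k S f" "Ck_on k T f"
  shows "Ck_on k (S \<union> T) f"
  using assms(3,4)
  by (induction k arbitrary: f) (auto intro: continuous_on_open_Un[OF assms(1,2)])

text \<open>For \<open>p = 1\<close> this is the classical function \<open>exp (- 1 / t)\<close>,
  extended by zero. The polynomial in \<open>1 / t\<close> is carried along because the family is
  then closed under differentiation, so that one induction over arbitrary \<open>p\<close> gives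
  smoothness.\<close>

definition flat :: "real poly \<Rightarrow> real \<Rightarrow> real"
  where "flat p t = (if t > 0 then poly p (1 / t) * exp (- 1 / t) else 0)"

lemma flat_nonpos: "t \<le> 0 \<Longrightarrow> flat p t = 0"
  by (simp add: flat_def)

lemma poly_exp_minus_tendsto_0: "((\<lambda>y. poly p y * exp (- y)) \<longlongrightarrow> (0::real)) at_top"
proof -
  have "((\<lambda>y::real. \<Sum>i\<le>degree p. coeff p i * (y ^ i / exp y)) \<longlongrightarrow> (\<Sum>i\<le>degree p. coeff p i * 0)) at_top"
    by (intro tendsto_intros tendsto_power_div_exp_0)
  then show ?thesis
    by (simp add: poly_altdef sum_distrib_right exp_minus divide_inverse mult.assoc)
qed

text \<open>Since the derivative of \<open>1 / t\<close> is \<open>- (1 / t)^2\<close>,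
  differentiating \<open>p (1 / t) exp (- 1 / t)\<close> replaces \<open>p\<close> by
  \<open>X^2 (p - p')\<close>. Only the point 0 needs a limit.\<close>

lemma has_real_derivative_flat:
  "(flat p has_real_derivative flat ([:0, 0, 1:] * (p - pderiv p)) t) (at t)"
proof -
  consider "t > 0" | "t < 0" | "t = 0" by linarith
  then show ?thesis
  proof cases
    case 1
    have "((\<lambda>t. poly p (1 / t) * exp (- 1 / t)) has_real_derivative
       flat ([:0, 0, 1:] * (p - pderiv p)) t) (at t)"
      using 1 by (auto intro!: derivative_eq_intros DERIV_chain2[OF poly_DERIV]
          simp: flat_def field_simps power2_eq_square)
    then show ?thesis
      by (rule has_field_derivative_transform_within_open[of _ _ _ "{0<..}"])
         (use 1 in \<open>auto simp: flat_def\<close>)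
  next
    case 2
    have "((\<lambda>t. 0) has_real_derivative flat ([:0, 0, 1:] * (p - pderiv p)) t) (at t)"
      using 2 by (simp add: flat_def)
    then show ?thesis
      by (rule has_field_derivative_transform_within_open[of _ _ _ "{..<0}"])
         (use 2 in \<open>auto simp: flat_def\<close>)
  next
    case 3
    have "((\<lambda>y. flat p y / y) \<longlongrightarrow> 0) (at_left 0)"
      by (rule tendsto_eventually) (auto simp: flat_def eventually_at_left_field intro!: exI[of _ "-1"])
    moreover have "((\<lambda>y. flat p y / y) \<longlongrightarrow> 0) (at_right 0)"
    proof -
      \<comment> \<open>With \<open>y = 1 / t\<close> the difference quotient at 0 is
        \<open>y p(y) exp (- y)\<close>, again a polynomial times \<open>exp (- y)\<close>, and
        \<open>y\<close> tends to infinity.\<close>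
      have "((\<lambda>y::real. poly ([:0, 1:] * p) (inverse y) * exp (- inverse y)) \<longlongrightarrow> 0) (at_right 0)"
        by (rule filterlim_compose[OF poly_exp_minus_tendsto_0 filterlim_inverse_at_top_right])
      then show ?thesis
        by (rule Lim_transform_eventually)
          (auto simp: flat_def eventually_at_right_field field_simps intro!: exI[of _ 1])
    qed
    ultimately have "((\<lambda>y. flat p y / y) \<longlongrightarrow> 0) (at 0)"
      by (rule filterlim_split_at)
    then show ?thesis
      using 3 by (simp add: has_field_derivative_iff flat_def)
  qed
qed

lemma Ck_on_flat:
  assumes "open S" "Ck_on k S f"
  shows "Ck_on k S (\<lambda>x. flat p (f x))"
  using assms(2)
proof (induction k arbitrary: p)
  case 0
  have "continuous_on UNIV (flat p)"
    by (meson DERIV_isCont continuous_at_imp_continuous_on has_real_derivative_flat)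
  then show ?case using 0
    by (auto intro: continuous_on_compose2)
next
  case (Suc k)
  have "(\<lambda>x. flat p (f x)) differentiable (at x)" if "x \<in> S" for x
    by (rule differentiableI[OF has_derivative_compose[OF has_derivative_dir_deriv
             has_real_derivative_flat[unfolded has_field_derivative_def]]])
      (use Suc.prems that in simp)
  moreover have "Ck_on k S (dir_deriv v (\<lambda>x. flat p (f x)))" for v
    by (rule Ck_on_cong[OF assms(1) _ Ck_on_mult[OF assms(1) Suc.IH[OF Ck_on_SucD[OF Suc.prems],
          of "[:0, 0, 1:] * (p - pderiv p)"], where g = "dir_deriv v f"]])
      (use Suc.prems in \<open>auto simp: dir_deriv_compose_real[OF _ has_real_derivative_flat]
          simp del: mult_pCons_left\<close>)
  ultimately show ?case by simp
qed

section \<open>Differentiation under the integral and the divergence theorem on balls\<close>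

text \<open>Dominated convergence for the difference quotients at \<open>t0\<close>.
  Differentiability is asked for almost everywhere and at \<open>t0\<close> alone, because the lemma
  will be applied to translates of a Lipschitz function that may have a kink along a sphere.\<close>

lemma has_real_derivative_lebesgue_integral:
  fixes F :: "real \<Rightarrow> 'a \<Rightarrow> real"
  assumes d: "0 < d"
    and int: "\<And>t. \<bar>t - t0\<bar> < d \<Longrightarrow> integrable M (F t)"
    and L: "integrable M L"
    and lip: "\<And>t x. \<bar>t - t0\<bar> < d \<Longrightarrow> x \<in> space M \<Longrightarrow> \<bar>F t x - F t0 x\<bar> \<le> \<bar>t - t0\<bar> * L x"
    and deriv: "AE x in M. ((\<lambda>t. F t x) has_real_derivative F' x) (at t0)"
    and F': "F' \<in> borel_measurable M"
  shows "((\<lambda>t. \<integral>x. F t x \<partial>M) has_real_derivative (\<integral>x. F' x \<partial>M)) (at t0)"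
proof -
  let ?J = "\<lambda>t. \<integral>x. F t x \<partial>M"
  have t0: "integrable M (F t0)" using int[of t0] d by simp
  have "(\<lambda>t. (?J t - ?J t0) / (t - t0)) \<midarrow>t0\<rightarrow> (\<integral>x. F' x \<partial>M)"
    unfolding LIMSEQ_SEQ_conv[symmetric]
  proof (intro allI impI, elim conjE)
    fix S :: "nat \<Rightarrow> real" assume ne: "\<forall>n. S n \<noteq> t0" and lim: "S \<longlonglongrightarrow> t0"
    from LIMSEQ_D[OF lim d] obtain N where N: "\<And>n. n \<ge> N \<Longrightarrow> \<bar>S n - t0\<bar> < d" by auto
    define q where "q = (\<lambda>n x. (F (S (n + N)) x - F t0 x) / (S (n + N) - t0))"
    have i: "integrable M (F (S (n + N)))" for n using int N by simp
    have "(\<lambda>n. \<integral>x. q n x \<partial>M) \<longlonglongrightarrow> (\<integral>x. F' x \<partial>M)"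
    proof (rule integral_dominated_convergence[where w = L])
      show "q n \<in> borel_measurable M" for n
        unfolding q_def using i t0 by (intro borel_measurable_divide borel_measurable_diff) auto
      show "AE x in M. norm (q n x) \<le> L x" for n
        using lip[OF N[of "n + N"]] ne by (auto simp: q_def field_simps)
      have S: "(\<lambda>n. S (n + N)) \<longlonglongrightarrow> t0" using lim by (rule LIMSEQ_ignore_initial_segment)
      show "AE x in M. (\<lambda>n. q n x) \<longlonglongrightarrow> F' x"
        using deriv
      proof eventually_elim
        case (elim x)
        then have "\<forall>S. (\<forall>n. S n \<noteq> t0) \<and> S \<longlonglongrightarrow> t0 \<longrightarrow>
            (\<lambda>n. (F (S n) x - F t0 x) / (S n - t0)) \<longlonglongrightarrow> F' x"
          unfolding has_field_derivative_iff
          by (rule LIMSEQ_SEQ_conv[where X = "\<lambda>t. (F t x - F t0 x) / (t - t0)", THEN iffD2])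
        from this[THEN spec, of "\<lambda>n. S (n + N)"] show ?case
          using ne S by (simp add: q_def)
      qed
    qed (use F' L in auto)
    moreover have "(\<integral>x. q n x \<partial>M) = (?J (S (n + N)) - ?J t0) / (S (n + N) - t0)" for n
      unfolding q_def using i[of n] t0 by simp
    ultimately show "(\<lambda>n. (?J (S n) - ?J t0) / (S n - t0)) \<longlonglongrightarrow> (\<integral>x. F' x \<partial>M)"
      using LIMSEQ_offset[of "\<lambda>n. (?J (S n) - ?J t0) / (S n - t0)" N] by simp
  qed
  then show ?thesis by (simp add: has_field_derivative_iff)
qed

lemma Ck_on_lipschitz_compact:
  fixes f :: "real^'n \<Rightarrow> real"
  assumes f: "Ck_on 1 S f" and K: "compact K" "convex K" "K \<subseteq> S"
  obtains L where "L \<ge> 0" "\<And>x y. x \<in> K \<Longrightarrow> y \<in> K \<Longrightarrow> \<bar>f x - f y\<bar> \<le> L * norm (x - y)"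
proof -
  let ?g = "\<lambda>x. \<Sum>i\<in>UNIV. \<bar>dir_deriv (axis i 1) f x\<bar>"
  have "continuous_on K ?g"
    using f K(3) by (intro continuous_intros) (auto intro: continuous_on_subset)
  then have "bounded (?g ` K)"
    using compact_continuous_image compact_imp_bounded K(1) by blast
  then obtain L where L: "L > 0" "\<And>x. x \<in> K \<Longrightarrow> ?g x \<le> L"
    unfolding bounded_pos by (auto simp: abs_le_iff)
  have d: "f differentiable (at x)" if "x \<in> K" for x
    using f K(3) that by auto
  have "onorm (\<lambda>v. dir_deriv v f x) \<le> L" if x: "x \<in> K" for x
  proof (rule onorm_bound)
    fix v :: "real^'n"
    have "\<bar>dir_deriv v f x\<bar> \<le> (\<Sum>i\<in>UNIV. \<bar>v $ i * dir_deriv (axis i 1) f x\<bar>)"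
      by (subst dir_deriv_axis_sum[OF d[OF x]]) (rule sum_abs)
    also have "\<dots> \<le> (\<Sum>i\<in>UNIV. norm v * \<bar>dir_deriv (axis i 1) f x\<bar>)"
      by (intro sum_mono) (simp add: abs_mult component_le_norm_cart mult_right_mono)
    also have "\<dots> \<le> L * norm v"
      using L(2)[OF x] by (simp add: sum_distrib_left[symmetric] mult.commute[of _ "norm v"] mult_left_mono)
    finally show "norm (dir_deriv v f x) \<le> L * norm v" by simp
  qed (use L in simp)
  then have "\<bar>f x - f y\<bar> \<le> L * norm (x - y)" if "x \<in> K" "y \<in> K" for x y
    using differentiable_bound[OF K(2) has_derivative_at_withinI[OF has_derivative_dir_deriv[OF d]], of L]
      that by auto
  with L(1) that show thesis by (meson less_imp_le)
qed

lemma norm_closest_point_cball: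
  fixes x :: "'a::euclidean_space"
  assumes "R > 0" "R \<le> norm x"
  shows "norm (closest_point (cball 0 R) x) = R"
proof -
  let ?z = "closest_point (cball 0 R) x"
  have "?z \<in> cball 0 R" by (rule closest_point_in_set) (use assms in auto)
  moreover have "dist x ?z \<le> dist x ((R / norm x) *\<^sub>R x)"
    by (rule closest_point_le) (use assms in auto)
  moreover have "dist x ((R / norm x) *\<^sub>R x) = norm x - R"
  proof -
    have "dist x ((R / norm x) *\<^sub>R x) = norm ((1 - R / norm x) *\<^sub>R x)"
      by (simp add: dist_norm algebra_simps)
    also have "\<dots> = (1 - R / norm x) * norm x"
      using assms by (subst norm_scaleR) (simp add: divide_le_eq_1)
    finally show ?thesis using assms by (auto simp add: left_diff_distrib)
  qed
  moreover have "norm x \<le> dist x ?z + norm ?z"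
    using norm_triangle_ineq[of "x - ?z" ?z] by (simp add: dist_norm)
  ultimately show ?thesis by simp
qed

lemma sphere_null_sets_lborel: "sphere a r \<in> null_sets (lborel :: 'a::euclidean_space measure)"
  using negligible_sphere[of a r] by (simp add: null_sets_completion_iff negligible_iff_null_sets)

lemma integral_lborel_translate:
  fixes f :: "'a::euclidean_space \<Rightarrow> real"
  assumes "f \<in> borel_measurable borel"
  shows "(\<integral>x. f (x + c) \<partial>lborel) = (\<integral>x. f x \<partial>lborel)"
proof -
  have "(\<integral>x. f x \<partial>lborel) = (\<integral>x. f x \<partial>(distr lborel borel ((+) c)))"
    by (simp add: lborel_distr_plus)
  also have "\<dots> = (\<integral>x. f (c + x) \<partial>lborel)"
    using assms by (subst integral_distr) auto
  finally show ?thesis by (simp add: add.commute)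
qed

text \<open>Extended by zero, \<open>f\<close> becomes a compactly supported Lipschitz function
  \<open>g\<close>. The integral of \<open>g (x + t v)\<close> over \<open>x\<close> does not depend
  on \<open>t\<close>, and its derivative at \<open>t = 0\<close> is the integral in
  question.\<close>

lemma set_integral_dir_deriv_eq_0:
  fixes f :: "real^'n \<Rightarrow> real"
  assumes S: "open S" "cball 0 R \<subseteq> S" and R: "R > 0" and f: "Ck_on 1 S f"
    and z: "\<And>x. norm x = R \<Longrightarrow> f x = 0"
  shows "(LINT x:ball 0 R|lborel. dir_deriv v f x) = 0"
proof -
  let ?c = "closest_point (cball (0::real^'n) R)"
  obtain L where L: "L \<ge> 0"
    "\<And>x y. x \<in> cball 0 R \<Longrightarrow> y \<in> cball 0 R \<Longrightarrow> \<bar>f x - f y\<bar> \<le> L * norm (x - y)"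
    using Ck_on_lipschitz_compact[OF f compact_cball convex_cball S(2)] by blast
  \<comment> \<open>Points outside the ball are projected onto the sphere, so composing with the
    nearest point projection is the extension by zero. As the projection is 1-Lipschitz,
    \<open>g\<close> inherits the Lipschitz constant of \<open>f\<close> on the closed ball.\<close>
  define g where "g = (\<lambda>x. f (?c x))"
  have c: "?c x \<in> cball 0 R" for x
    by (rule closest_point_in_set) (use R in auto)
  have g_lip: "\<bar>g x - g y\<bar> \<le> L * norm (x - y)" for x y
  proof -
    have "\<bar>g x - g y\<bar> \<le> L * norm (?c x - ?c y)"
      unfolding g_def using L(2) c by blast
    also have "\<dots> \<le> L * norm (x - y)"
      using closest_point_lipschitz[of "cball (0::real^'n) R" x y] L(1) R
      by (intro mult_left_mono) (auto simp: dist_norm)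
    finally show ?thesis .
  qed
  have g_in: "g x = f x" if "norm x \<le> R" for x
    using that by (simp add: g_def closest_point_self)
  have g_out: "g x = 0" if "R \<le> norm x" for x
    using z norm_closest_point_cball[OF R that] by (simp add: g_def)
  have g_cont: "continuous_on A g" for A
  proof (rule continuous_on_subset[of UNIV])
    have "L-lipschitz_on UNIV g"
      using g_lip L(1) by (auto simp: lipschitz_on_def dist_norm)
    then show "continuous_on UNIV g" by (rule lipschitz_on_continuous_on)
  qed simp
  \<comment> \<open>This ball contains the supports of all translates with \<open>|t| < 1\<close>,
    so a multiple of its indicator dominates the difference quotients.\<close>
  let ?K = "cball (0::real^'n) (R + norm v)"
  let ?F' = "\<lambda>x. indicator (ball 0 R) x *\<^sub>R dir_deriv v f x"
  have out: "g (x + t *\<^sub>R v) = 0" if "\<bar>t\<bar> < 1" "x \<notin> ?K" for x t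
  proof (rule g_out)
    have "norm x \<le> norm (x + t *\<^sub>R v) + norm (t *\<^sub>R v)"
      using norm_triangle_ineq4[of "x + t *\<^sub>R v" "t *\<^sub>R v"] by simp
    moreover have "norm (t *\<^sub>R v) \<le> norm v"
      using that(1) by (simp add: mult_left_le_one_le)
    ultimately show "R \<le> norm (x + t *\<^sub>R v)" using that(2) by simp
  qed
  have "((\<lambda>t. \<integral>x. g (x + t *\<^sub>R v) \<partial>lborel) has_real_derivative (\<integral>x. ?F' x \<partial>lborel)) (at 0)"
  proof (rule has_real_derivative_lebesgue_integral[where d = 1 and L = "\<lambda>x. L * norm v * indicator ?K x"])
    show "integrable lborel (\<lambda>x. g (x + t *\<^sub>R v))" if "\<bar>t - 0\<bar> < 1" for t
    proof -
      have "integrable lborel (\<lambda>x. indicator ?K x *\<^sub>R g (x + t *\<^sub>R v))"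
        by (intro borel_integrable_compact compact_cball continuous_on_compose2[OF g_cont[of UNIV]]
              continuous_intros) auto
      moreover have "indicator ?K x *\<^sub>R g (x + t *\<^sub>R v) = g (x + t *\<^sub>R v)" for x
        using out[of t x] that by (auto simp: indicator_def)
      ultimately show ?thesis by (simp only:)
    qed
    show "\<bar>g (x + t *\<^sub>R v) - g (x + 0 *\<^sub>R v)\<bar> \<le> \<bar>t - 0\<bar> * (L * norm v * indicator ?K x)"
      if "\<bar>t - 0\<bar> < 1" for t x
      using g_lip[of "x + t *\<^sub>R v" x] out[of t x] out[of 0 x] that
      by (auto simp: indicator_def mult_ac)
    show "integrable lborel (\<lambda>x. L * norm v * indicator ?K x)"
      by (intro integrable_mult_right integrable_real_indicator emeasure_compact_finite compact_cball)
         simp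
    have cont: "continuous_on (ball 0 R) (dir_deriv v f)"
      by (rule continuous_on_subset[of S]) (use f S(2) ball_subset_cball[of 0 R] in auto)
    show "?F' \<in> borel_measurable lborel"
      unfolding measurable_lborel2
      by (rule borel_measurable_continuous_on_indicator[OF _ cont]) simp
    show "AE x in lborel. ((\<lambda>t. g (x + t *\<^sub>R v)) has_real_derivative ?F' x) (at 0)"
    proof (rule AE_I'[OF sphere_null_sets_lborel[of 0 R]], rule subsetI)
      fix x :: "real^'n"
      assume "x \<in> {x \<in> space lborel. \<not> ((\<lambda>t. g (x + t *\<^sub>R v)) has_real_derivative ?F' x) (at 0)}"
      then have nd: "\<not> ((\<lambda>t. g (x + t *\<^sub>R v)) has_real_derivative ?F' x) (at 0)"
        by blast
      show "x \<in> sphere 0 R"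
      proof (rule ccontr)
        assume "x \<notin> sphere 0 R"
        then consider "norm x < R" | "norm x > R" by fastforce
        then have "(g has_derivative (\<lambda>w. indicator (ball 0 R) x * dir_deriv w f x)) (at x)"
        proof cases
          case 1
          then have "x \<in> S" using S(2) by auto
          then have "(f has_derivative (\<lambda>w. dir_deriv w f x)) (at x)"
            by (intro has_derivative_dir_deriv) (use f in auto)
          then have "(g has_derivative (\<lambda>w. dir_deriv w f x)) (at x)"
            by (rule has_derivative_transform_within_open[of _ _ _ _ "ball 0 R"])
               (use 1 in \<open>auto simp: g_in\<close>)
          with 1 show ?thesis by simp
        next
          case 2
          have "((\<lambda>_. 0) has_derivative (\<lambda>w. 0)) (at x)" by simp
          then have "(g has_derivative (\<lambda>w. 0)) (at x)"
            by (rule has_derivative_transform_within_open[of _ _ _ _ "- cball 0 R"])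
               (use 2 in \<open>auto simp: g_out\<close>)
          with 2 show ?thesis by simp
        qed
        then have g': "(g has_derivative (\<lambda>w. indicator (ball 0 R) x * dir_deriv w f x)) (at (x + 0 *\<^sub>R v))"
          by simp
        have "((\<lambda>t. x + t *\<^sub>R v) has_derivative (\<lambda>t. t *\<^sub>R v)) (at 0)"
          by (auto intro!: derivative_eq_intros)
        from has_derivative_compose[OF this g']
        have "((\<lambda>t. g (x + t *\<^sub>R v)) has_derivative (\<lambda>t. indicator (ball 0 R) x * dir_deriv (t *\<^sub>R v) f x)) (at 0)" .
        moreover have "(\<lambda>t. indicator (ball 0 R) x * dir_deriv (t *\<^sub>R v) f x) = (*) (?F' x)"
        proof
          fix t
          show "indicator (ball 0 R) x * dir_deriv (t *\<^sub>R v) f x = ?F' x * t"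
            using linear_cmul[OF has_derivative_linear[OF g'], of t v] by (auto simp: mult.commute)
        qed
        ultimately show False using nd unfolding has_field_derivative_def by (simp only:)
      qed
    qed
  qed simp
  moreover have "(\<integral>x. g (x + t *\<^sub>R v) \<partial>lborel) = (\<integral>x. g x \<partial>lborel)" for t
    by (rule integral_lborel_translate) (use g_cont in \<open>simp add: borel_measurable_continuous_onI\<close>)
  ultimately have "((\<lambda>t. \<integral>x. g x \<partial>lborel) has_real_derivative (\<integral>x. ?F' x \<partial>lborel)) (at 0)"
    by simp
  then show ?thesis
    using DERIV_unique[OF _ DERIV_const] by (auto simp: set_lebesgue_integral_def)
qed

section \<open>Harmonic functions on the unit ball\<close>

lemma set_integrable_ball_if_continuous_on_cball:
  fixes f :: "real^'n \<Rightarrow> real"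
  assumes "continuous_on (cball 0 R) f"
  shows "set_integrable lborel (ball 0 R) f"
  by (rule set_integrable_subset[of _ "cball 0 R"])
    (use borel_integrable_compact[OF compact_cball assms] in \<open>auto simp: set_integrable_def\<close>)

lemma set_lebesgue_integral_sum:
  fixes f :: "'i \<Rightarrow> 'a \<Rightarrow> real"
  assumes "\<And>i. i \<in> I \<Longrightarrow> set_integrable M A (f i)"
  shows "(LINT x:A|M. \<Sum>i\<in>I. f i x) = (\<Sum>i\<in>I. LINT x:A|M. f i x)"
  using assms by (simp add: set_lebesgue_integral_def set_integrable_def sum_distrib_left)

lemma set_integral_eq_0_imp_eq_0:
  fixes f :: "'a::euclidean_space \<Rightarrow> real"
  assumes S: "open S" and f: "continuous_on S f" "\<And>x. x \<in> S \<Longrightarrow> f x \<ge> 0"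
    and i: "set_integrable lborel S f" "(LINT x:S|lborel. f x) = 0" and x: "x \<in> S"
  shows "f x = 0"
proof (rule ccontr)
  assume nz: "f x \<noteq> 0"
  define N where "N = S \<inter> f -` (- {0})"
  have "open N"
    unfolding N_def by (rule continuous_open_preimage[OF f(1) S]) auto
  have "AE x in lborel. indicator S x *\<^sub>R f x = 0"
    using i f(2) unfolding set_integrable_def set_lebesgue_integral_def
    by (subst integral_nonneg_eq_0_iff_AE[symmetric]) (auto simp: indicator_def)
  \<comment> \<open>Almost every point of the open set \<open>N\<close> lies in the closed set
    \<open>{}\<close>; for a closed set this implies that every point of \<open>N\<close> does, so
    \<open>N\<close> is empty.\<close>
  then have "AE x in lborel. x \<in> N \<longrightarrow> x \<in> {}"
    by eventually_elim (auto simp: N_def indicator_def)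
  then have "AE x \<in> N in lebesgue. x \<in> {}"
    by (rule AE_completion)
  from mem_closed_if_AE_lebesgue_open[OF \<open>open N\<close> closed_empty this, of x] show False
    using x nz by (simp add: N_def)
qed

section \<open>Divergence-free fields and dilations of harmonic functions\<close>

lemma sum_component_squares: "(\<Sum>j\<in>UNIV. (x::real^'n) $ j * x $ j) = (norm x)\<^sup>2"
  by (simp add: power2_norm_eq_inner inner_vec_def)

lemma has_derivative_sum_component_squares:
  "((\<lambda>x::real^'n. \<Sum>j\<in>UNIV. x $ j * x $ j) has_derivative
    (\<lambda>v. \<Sum>j\<in>UNIV. x $ j * v $ j + v $ j * x $ j)) (at x)"
  by (intro has_derivative_sum has_derivative_mult has_derivative_vec_nth')

lemmas differentiable_sum_component_squares = differentiableI[OF has_derivative_sum_component_squares]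

lemma dir_deriv_sum_component_squares:
  "dir_deriv (axis i 1) (\<lambda>x::real^'n. \<Sum>j\<in>UNIV. x $ j * x $ j) x = 2 * x $ i"
  using dir_deriv_eq[OF has_derivative_sum_component_squares, of x "axis i 1"]
  by (simp add: axis_def sum.distrib if_distrib[of "(*) _"] if_distrib[of "\<lambda>c. c * _"] cong: if_cong)

lemma Ck_on_sum_component_squares: "open S \<Longrightarrow> Ck_on k S (\<lambda>x::real^'n. \<Sum>j\<in>UNIV. x $ j * x $ j)"
  by (intro Ck_on_sum Ck_on_mult Ck_on_vec_nth)

text \<open>Integrate the divergence of the field \<open>(1 - \<bar>x\<bar>\<^sup>2) G\<close>, which vanishes on the unit sphere.\<close>

lemma set_integral_radial_part_divergence_free:
  fixes G :: "'n::finite \<Rightarrow> real^'n \<Rightarrow> real"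
  assumes S: "open S" "cball 0 1 \<subseteq> S" and G: "\<And>i. Ck_on 1 S (G i)"
    and div: "\<And>x. x \<in> ball 0 1 \<Longrightarrow> (\<Sum>i\<in>UNIV. dir_deriv (axis i 1) (G i) x) = 0"
  shows "(LINT x:ball 0 1|lborel. \<Sum>i\<in>UNIV. x $ i * G i x) = 0"
proof -
  define w where "w = (\<lambda>x::real^'n. 1 - (\<Sum>j\<in>UNIV. x $ j * x $ j))"
  have w: "Ck_on 1 S w"
    unfolding w_def by (intro Ck_on_diff Ck_on_const Ck_on_sum_component_squares S)
  have dw: "dir_deriv (axis i 1) w x = - 2 * x $ i" for i x
    unfolding w_def
    by (simp add: dir_deriv_diff differentiable_sum_component_squares dir_deriv_sum_component_squares)
  have wG: "Ck_on 1 S (\<lambda>x. w x * G i x)" for i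
    by (intro Ck_on_mult w G S)
  have 0: "(LINT x:ball 0 1|lborel. dir_deriv (axis i 1) (\<lambda>x. w x * G i x) x) = 0" for i
    by (rule set_integral_dir_deriv_eq_0[OF S _ wG]) (auto simp: w_def sum_component_squares)
  have int: "set_integrable lborel (ball 0 1) (dir_deriv (axis i 1) (\<lambda>x. w x * G i x))" for i
    by (rule set_integrable_ball_if_continuous_on_cball, rule continuous_on_subset[OF _ S(2)])
      (use wG[of i] in simp)
  have "0 = (LINT x:ball 0 1|lborel. \<Sum>i\<in>UNIV. dir_deriv (axis i 1) (\<lambda>x. w x * G i x) x)"
    using 0 int by (simp add: set_lebesgue_integral_sum)
  also have "\<dots> = (LINT x:ball 0 1|lborel. - 2 * (\<Sum>i\<in>UNIV. x $ i * G i x))"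
  proof (rule set_lebesgue_integral_cong; (intro allI impI)?)
    fix x :: "real^'n" assume x: "x \<in> ball 0 1"
    then have "x \<in> S" using S(2) by auto
    then have "dir_deriv (axis i 1) (\<lambda>x. w x * G i x) x
        = w x * dir_deriv (axis i 1) (G i) x + - 2 * x $ i * G i x" for i
      using w G[of i] by (subst dir_deriv_mult) (auto simp: dw)
    then have "(\<Sum>i\<in>UNIV. dir_deriv (axis i 1) (\<lambda>x. w x * G i x) x)
        = w x * (\<Sum>i\<in>UNIV. dir_deriv (axis i 1) (G i) x) - 2 * (\<Sum>i\<in>UNIV. x $ i * G i x)"
      by (simp add: sum.distrib sum_distrib_left sum_negf sum_subtractf mult_ac)
    then show "(\<Sum>i\<in>UNIV. dir_deriv (axis i 1) (\<lambda>x. w x * G i x) x)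
        = - 2 * (\<Sum>i\<in>UNIV. x $ i * G i x)"
      using div[OF x] by simp
  qed simp
  also have "\<dots> = - 2 * (LINT x:ball 0 1|lborel. \<Sum>i\<in>UNIV. x $ i * G i x)"
    by (rule set_integral_mult_right)
  finally show ?thesis by simp
qed

lemma has_real_derivative_dilation:
  fixes u :: "real^'n \<Rightarrow> real"
  assumes u: "u differentiable (at (A t *\<^sub>R x))" and A: "(A has_real_derivative A') (at t)"
  shows "((\<lambda>t. u (A t *\<^sub>R x)) has_real_derivative
     A' * (\<Sum>i\<in>UNIV. x $ i * dir_deriv (axis i 1) u (A t *\<^sub>R x))) (at t)"
proof -
  have "((\<lambda>t. A t *\<^sub>R x) has_derivative (\<lambda>h. (A' * h) *\<^sub>R x)) (at t)"
    using A unfolding has_field_derivative_def by (rule has_derivative_scaleR_left)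
  from has_derivative_compose[OF this has_derivative_dir_deriv[OF u]]
  have "((\<lambda>t. u (A t *\<^sub>R x)) has_derivative (\<lambda>h. dir_deriv ((A' * h) *\<^sub>R x) u (A t *\<^sub>R x))) (at t)" .
  moreover have "dir_deriv ((A' * h) *\<^sub>R x) u (A t *\<^sub>R x)
      = A' * (\<Sum>i\<in>UNIV. x $ i * dir_deriv (axis i 1) u (A t *\<^sub>R x)) * h" for h
    by (subst dir_deriv_axis_sum[OF u]) (simp add: sum_distrib_left sum_distrib_right mult_ac)
  ultimately show ?thesis by (simp add: has_field_derivative_def)
qed

lemma harmonic_onD:
  assumes "harmonic_on S u"
  shows "Ck_on 2 S u" "Ck_on 1 S u" "Ck_on 1 S (dir_deriv v u)" "continuous_on S u"
    "continuous_on S (dir_deriv v u)"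
    "x \<in> S \<Longrightarrow> u differentiable (at x)" "x \<in> S \<Longrightarrow> dir_deriv v u differentiable (at x)"
    "x \<in> S \<Longrightarrow> (\<Sum>i\<in>UNIV. dir_deriv (axis i 1) (dir_deriv (axis i 1) u) x) = 0"
proof -
  have 2: "Ck_on (Suc 1) S u"
    using assms by (simp add: harmonic_on_def numeral_2_eq_2)
  from 2 show "Ck_on 2 S u" by (simp add: numeral_2_eq_2)
  from 2 show "Ck_on 1 S u" by (rule Ck_on_SucD)
  from 2 show D: "Ck_on 1 S (dir_deriv v u)" by simp
  from 2 show "continuous_on S u" by (rule Ck_on_imp_continuous)
  from D show "continuous_on S (dir_deriv v u)" by (rule Ck_on_imp_continuous)
  show "x \<in> S \<Longrightarrow> u differentiable (at x)" "x \<in> S \<Longrightarrow> dir_deriv v u differentiable (at x)"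
    using 2 D by simp_all
  show "x \<in> S \<Longrightarrow> (\<Sum>i\<in>UNIV. dir_deriv (axis i 1) (dir_deriv (axis i 1) u) x) = 0"
    using assms by (simp add: harmonic_on_def laplacian_def)
qed

text \<open>For \<open>u = \<Sum> u\<^sub>k\<close> and \<open>v = \<Sum> v\<^sub>k\<close> with homogeneous harmonic polynomials
  \<open>u\<^sub>k\<close>, \<open>v\<^sub>k\<close> of degree \<open>k\<close>, orthogonality of spherical harmonics of different degree makes
  \<open>\<integral> u (a x) v (b x) dx\<close> a power series in \<open>a b\<close>.\<close>

lemma harmonic_dilation_product_integral:
  fixes u v :: "real^'n \<Rightarrow> real"
  assumes u: "harmonic_on (ball 0 1) u" and v: "harmonic_on (ball 0 1) v"
    and A: "\<And>t. t \<in> {l<..<m} \<Longrightarrow> (A has_real_derivative A' t) (at t)"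
    and B: "\<And>t. t \<in> {l<..<m} \<Longrightarrow> (B has_real_derivative B' t) (at t)"
    and A': "continuous_on {l<..<m} A'" and B': "continuous_on {l<..<m} B'"
    and A1: "\<And>t. t \<in> {l<..<m} \<Longrightarrow> \<bar>A t\<bar> < 1" and B1: "\<And>t. t \<in> {l<..<m} \<Longrightarrow> \<bar>B t\<bar> < 1"
    and AB: "\<And>t. t \<in> {l<..<m} \<Longrightarrow> A' t * B t + A t * B' t = 0"
    and s: "s \<in> {l<..<m}" "t \<in> {l<..<m}"
  shows "(LINT x:ball 0 1|lborel. u (A s *\<^sub>R x) * v (B s *\<^sub>R x))
       = (LINT x:ball 0 1|lborel. u (A t *\<^sub>R x) * v (B t *\<^sub>R x))"
proof (rule DERIV_isconst3[of l m s t "\<lambda>t. LINT x:ball 0 1|lborel. u (A t *\<^sub>R x) * v (B t *\<^sub>R x)"])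
  show "l < m" using s by auto
  let ?D = "\<lambda>i. dir_deriv (axis i 1) :: (real^'n \<Rightarrow> real) \<Rightarrow> real^'n \<Rightarrow> real"
  \<comment> \<open>The derivative of the integrand in \<open>t\<close> is the inner product of
    \<open>x\<close> with the field \<open>G t\<close>. This is the shape that
    \<open>set_integral_radial_part_divergence_free\<close> integrates to zero, so it remains to see
    that \<open>G t\<close> is divergence free.\<close>
  define G where "G = (\<lambda>t i x. A' t * (?D i u (A t *\<^sub>R x) * v (B t *\<^sub>R x))
      + B' t * (u (A t *\<^sub>R x) * ?D i v (B t *\<^sub>R x)))"
  define g where "g = (\<lambda>t x. \<Sum>i\<in>UNIV. x $ i * G t i x)"
  have small: "c *\<^sub>R x \<in> ball 0 1" if "\<bar>c\<bar> < 1" "x \<in> cball 0 1" for c and x :: "real^'n"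
    using that mult_mono[of "\<bar>c\<bar>" "\<bar>c\<bar>" "norm x" 1] by auto
  have deriv: "((\<lambda>t. u (A t *\<^sub>R x) * v (B t *\<^sub>R x)) has_real_derivative g t x) (at t)"
    if t: "t \<in> {l<..<m}" and x: "x \<in> cball 0 1" for t x
  proof -
    have "((\<lambda>t. u (A t *\<^sub>R x) * v (B t *\<^sub>R x)) has_real_derivative
       u (A t *\<^sub>R x) * (B' t * (\<Sum>i\<in>UNIV. x $ i * ?D i v (B t *\<^sub>R x)))
     + (A' t * (\<Sum>i\<in>UNIV. x $ i * ?D i u (A t *\<^sub>R x))) * v (B t *\<^sub>R x)) (at t)"
      by (intro DERIV_mult' has_real_derivative_dilation A B t harmonic_onD(6)[OF u]
            harmonic_onD(6)[OF v] small x A1 B1)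
    moreover have "u (A t *\<^sub>R x) * (B' t * (\<Sum>i\<in>UNIV. x $ i * ?D i v (B t *\<^sub>R x)))
     + (A' t * (\<Sum>i\<in>UNIV. x $ i * ?D i u (A t *\<^sub>R x))) * v (B t *\<^sub>R x) = g t x"
      unfolding g_def G_def
      by (simp add: sum_distrib_left sum_distrib_right sum.distrib[symmetric] algebra_simps)
    ultimately show ?thesis by simp
  qed
  have contA: "continuous_on {l<..<m} A" and contB: "continuous_on {l<..<m} B"
    by (auto intro!: continuous_at_imp_continuous_on DERIV_isCont[OF A] DERIV_isCont[OF B])
  have cd: "continuous_on ({l<..<m} \<times> cball 0 1) (\<lambda>p. f (C (fst p) *\<^sub>R snd p))"
    if "continuous_on (ball (0::real^'n) 1) f" "continuous_on {l<..<m} C"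
      "\<And>t. t \<in> {l<..<m} \<Longrightarrow> \<bar>C t\<bar> < 1" for f :: "real^'n \<Rightarrow> real" and C
    by (rule continuous_on_compose2[OF that(1)])
      (auto intro!: continuous_intros continuous_on_compose2[OF that(2)] small[simplified] that(3)[simplified])
  have cf: "continuous_on ({l<..<m} \<times> cball 0 1) (\<lambda>p. f (fst p))"
    if "continuous_on {l<..<m} f" for f :: "real \<Rightarrow> real"
    by (rule continuous_on_compose2[OF that]) (auto intro!: continuous_intros)
  have cg: "continuous_on ({l<..<m} \<times> cball 0 1) (\<lambda>p. g (fst p) (snd p))"
    unfolding g_def G_def
    by (intro continuous_intros cf[OF A'] cf[OF B'] cd[OF _ contA A1] cd[OF _ contB B1]
          harmonic_onD(4,5)[OF u] harmonic_onD(4,5)[OF v])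
  have cuv: "continuous_on (cball 0 1) (\<lambda>x. u (A t *\<^sub>R x) * v (B t *\<^sub>R x))"
    if "t \<in> {l<..<m}" for t
    by (intro continuous_on_mult continuous_on_compose2[OF harmonic_onD(4)[OF u]]
        continuous_on_compose2[OF harmonic_onD(4)[OF v]] continuous_intros)
      (use small[OF A1[OF that]] small[OF B1[OF that]] in auto)
  fix t0 assume t0: "t0 \<in> {l<..<m}"
  define d where "d = min (t0 - l) (m - t0) / 2"
  have d: "d > 0" "{t0 - d..t0 + d} \<subseteq> {l<..<m}"
    using t0 by (auto simp: d_def min_def field_simps)
  have "compact ((\<lambda>p. g (fst p) (snd p)) ` ({t0 - d..t0 + d} \<times> cball 0 1))"
    by (intro compact_continuous_image compact_Times continuous_on_subset[OF cg]) (use d in auto)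
  then have "bounded ((\<lambda>p. g (fst p) (snd p)) ` ({t0 - d..t0 + d} \<times> cball 0 1))"
    by (rule compact_imp_bounded)
  then obtain M where M0: "M > 0"
    "\<And>p. p \<in> {t0 - d..t0 + d} \<times> cball 0 1 \<Longrightarrow> \<bar>g (fst p) (snd p)\<bar> \<le> M"
    unfolding bounded_pos by auto
  have M: "\<bar>g t x\<bar> \<le> M" if "t \<in> {t0 - d..t0 + d}" "x \<in> cball 0 1" for t x
    using M0(2)[of "(t, x)"] that by simp
  have "((\<lambda>t. LINT x:ball 0 1|lborel. u (A t *\<^sub>R x) * v (B t *\<^sub>R x)) has_real_derivative
      (LINT x:ball 0 1|lborel. g t0 x)) (at t0)"
    unfolding set_lebesgue_integral_def
  proof (rule has_real_derivative_lebesgue_integral[OF d(1), where L = "\<lambda>x. M * indicator (ball 0 1) x"])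
    show "integrable lborel (\<lambda>x. indicator (ball 0 1) x *\<^sub>R (u (A t *\<^sub>R x) * v (B t *\<^sub>R x)))"
      if "\<bar>t - t0\<bar> < d" for t
      using set_integrable_ball_if_continuous_on_cball[OF cuv] d that
      unfolding set_integrable_def by (auto simp: abs_less_iff subset_iff)
    show "integrable lborel (\<lambda>x. M * indicator (ball 0 1) x)"
      by (intro integrable_mult_right integrable_real_indicator emeasure_bounded_finite) auto
    show "(\<lambda>x. indicator (ball 0 1) x *\<^sub>R g t0 x) \<in> borel_measurable lborel"
      unfolding measurable_lborel2
    proof (rule borel_measurable_continuous_on_indicator)
      have "continuous_on (ball 0 1) ((\<lambda>p. g (fst p) (snd p)) \<circ> (\<lambda>x. (t0, x)))"
        by (intro continuous_on_compose continuous_intros continuous_on_subset[OF cg]) (use t0 in auto)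
      then show "continuous_on (ball 0 1) (g t0)" by (simp add: o_def)
    qed simp
    show "AE x in lborel. ((\<lambda>t. indicator (ball 0 1) x *\<^sub>R (u (A t *\<^sub>R x) * v (B t *\<^sub>R x)))
        has_real_derivative indicator (ball 0 1) x *\<^sub>R g t0 x) (at t0)"
      using deriv[OF t0] by (intro AE_I2) (auto simp: indicator_def)
    show "\<bar>indicator (ball 0 1) x *\<^sub>R (u (A t *\<^sub>R x) * v (B t *\<^sub>R x))
        - indicator (ball 0 1) x *\<^sub>R (u (A t0 *\<^sub>R x) * v (B t0 *\<^sub>R x))\<bar>
        \<le> \<bar>t - t0\<bar> * (M * indicator (ball 0 1) x)"
      if t: "\<bar>t - t0\<bar> < d" for t x
    proof (cases "x \<in> ball 0 1")
      case True
      have "norm (u (A t *\<^sub>R x) * v (B t *\<^sub>R x) - u (A t0 *\<^sub>R x) * v (B t0 *\<^sub>R x)) \<le> M * norm (t - t0)"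
      proof (rule field_differentiable_bound[of "{t0 - d..t0 + d}"])
        show "((\<lambda>t. u (A t *\<^sub>R x) * v (B t *\<^sub>R x)) has_real_derivative g z x) (at z within {t0 - d..t0 + d})"
          if "z \<in> {t0 - d..t0 + d}" for z
          by (rule has_field_derivative_at_within[OF deriv]) (use that d(2) True in auto)
      qed (use M[of _ x] True t d(1) in \<open>auto simp: abs_less_iff\<close>)
      with True show ?thesis by (simp add: mult.commute)
    qed simp
  qed
  moreover have "(LINT x:ball 0 1|lborel. g t0 x) = 0"
    unfolding g_def
  proof (rule set_integral_radial_part_divergence_free)
    define S where "S = (\<lambda>x. A t0 *\<^sub>R x) -` ball (0::real^'n) 1 \<inter> (\<lambda>x. B t0 *\<^sub>R x) -` ball (0::real^'n) 1"
    show S: "open S"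
      unfolding S_def by (intro open_Int open_vimage continuous_intros open_ball)
    show "cball 0 1 \<subseteq> S"
      using small[OF A1[OF t0]] small[OF B1[OF t0]] by (auto simp: S_def)
    have SA: "x \<in> S \<Longrightarrow> A t0 *\<^sub>R x \<in> ball 0 1" and SB: "x \<in> S \<Longrightarrow> B t0 *\<^sub>R x \<in> ball 0 1" for x
      by (simp_all add: S_def)
    show "Ck_on 1 S (G t0 i)" for i
      unfolding G_def
      by (intro Ck_on_add Ck_on_mult Ck_on_const S Ck_on_scaleR[OF S harmonic_onD(2)[OF u] SA]
          Ck_on_scaleR[OF S harmonic_onD(3)[OF u] SA] Ck_on_scaleR[OF S harmonic_onD(2)[OF v] SB]
          Ck_on_scaleR[OF S harmonic_onD(3)[OF v] SB])
    fix x :: "real^'n" assume "x \<in> ball 0 1"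
    then have xA: "A t0 *\<^sub>R x \<in> ball 0 1" and xB: "B t0 *\<^sub>R x \<in> ball 0 1"
      using small A1[OF t0] B1[OF t0] by auto
    have ds: "(\<lambda>x. f (c *\<^sub>R x)) differentiable (at x)"
      if "f differentiable (at (c *\<^sub>R x))" for f :: "real^'n \<Rightarrow> real" and c
      by (rule differentiableI[OF has_derivative_compose[OF has_derivative_scaleR_arg
             has_derivative_dir_deriv[OF that]]])
    note d = harmonic_onD(6,7)[OF u xA] harmonic_onD(6,7)[OF v xB]
    \<comment> \<open>After summation over \<open>i\<close> the outer two terms contain the
      Laplacians of \<open>u\<close> and \<open>v\<close>. The mixed term, with the product of the
      gradients, has the derivative of \<open>A t * B t\<close> as its factor, which is zero by
      \<open>AB\<close>.\<close>
    have "?D i (G t0 i) x = A' t0 * A t0 * (?D i (?D i u) (A t0 *\<^sub>R x) * v (B t0 *\<^sub>R x))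
       + (A' t0 * B t0 + A t0 * B' t0) * (?D i u (A t0 *\<^sub>R x) * ?D i v (B t0 *\<^sub>R x))
       + B' t0 * B t0 * (u (A t0 *\<^sub>R x) * ?D i (?D i v) (B t0 *\<^sub>R x))" for i
      unfolding G_def
      by (simp add: dir_deriv_add dir_deriv_mult differentiable_mult d[THEN ds] d[THEN dir_deriv_scaleR])
        (simp add: algebra_simps)
    then have "(\<Sum>i\<in>UNIV. ?D i (G t0 i) x) =
        A' t0 * A t0 * ((\<Sum>i\<in>UNIV. ?D i (?D i u) (A t0 *\<^sub>R x)) * v (B t0 *\<^sub>R x))
      + B' t0 * B t0 * (u (A t0 *\<^sub>R x) * (\<Sum>i\<in>UNIV. ?D i (?D i v) (B t0 *\<^sub>R x)))"
      using AB[OF t0] by (simp add: sum.distrib sum_distrib_left sum_distrib_right)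
    then show "(\<Sum>i\<in>UNIV. ?D i (G t0 i) x) = 0"
      using harmonic_onD(8)[OF u xA] harmonic_onD(8)[OF v xB] by simp
  qed
  ultimately show "((\<lambda>t. LINT x:ball 0 1|lborel. u (A t *\<^sub>R x) * v (B t *\<^sub>R x))
      has_real_derivative 0) (at t0)" by simp
qed (use s in auto)

lemma harmonic_on_const: "harmonic_on S (\<lambda>_. c)"
  unfolding harmonic_on_def by (intro conjI Ck_on_const) (simp add: laplacian_def)

lemma harmonic_on_diff:
  assumes S: "open S" and u: "harmonic_on S u" and v: "harmonic_on S v"
  shows "harmonic_on S (\<lambda>x. u x - v x)"
  unfolding harmonic_on_def
proof (intro conjI ballI Ck_on_diff S harmonic_onD(1)[OF u] harmonic_onD(1)[OF v])
  fix x assume x: "x \<in> S"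
  have "dir_deriv w (dir_deriv w (\<lambda>x. u x - v x)) x
      = dir_deriv w (dir_deriv w u) x - dir_deriv w (dir_deriv w v) x" for w
  proof -
    have "dir_deriv w (\<lambda>x. dir_deriv w u x - dir_deriv w v x) x = dir_deriv w (dir_deriv w (\<lambda>x. u x - v x)) x"
      by (rule dir_deriv_cong[OF S x])
        (use x in \<open>auto intro!: differentiable_diff dir_deriv_diff[symmetric]
           harmonic_onD(6,7)[OF u] harmonic_onD(6,7)[OF v]\<close>)
    then show ?thesis
      by (simp add: dir_deriv_diff harmonic_onD(7)[OF u x] harmonic_onD(7)[OF v x])
  qed
  then show "laplacian (\<lambda>x. u x - v x) x = 0"
    using harmonic_onD(8)[OF u x] harmonic_onD(8)[OF v x]
    by (simp add: laplacian_def sum_subtractf)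
qed

section \<open>Mean value property and integrability\<close>

lemma integral_lborel_scaleR:
  fixes f :: "'a::euclidean_space \<Rightarrow> real"
  assumes f[measurable]: "f \<in> borel_measurable borel" and r: "r > 0"
  shows "(\<integral>x. f x \<partial>lborel) = r ^ DIM('a) * (\<integral>x. f (r *\<^sub>R x) \<partial>lborel)"
proof -
  have "(\<integral>x. f x \<partial>lborel)
      = (\<integral>x. f x \<partial>density (distr lborel borel (\<lambda>x. r *\<^sub>R x)) (\<lambda>_. ennreal (r ^ DIM('a))))"
    using lborel_affine[of r "0::'a"] r by simp
  also have "\<dots> = (\<integral>x. r ^ DIM('a) *\<^sub>R f x \<partial>distr lborel borel (\<lambda>x. r *\<^sub>R x))"
    using r by (intro integral_density) auto
  also have "\<dots> = r ^ DIM('a) * (\<integral>x. f (r *\<^sub>R x) \<partial>lborel)"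
    by (subst integral_distr) auto
  finally show ?thesis .
qed

text \<open>Taking \<open>v = 1\<close> and \<open>B = 0\<close> in the dilation identity leaves
  \<open>A\<close> free, so the integral of \<open>u (r x)\<close> over the unit ball is the same
  for all \<open>r\<close> in \<open>{-1<..<1}\<close>, and for \<open>r = 0\<close> the integrand
  is the constant \<open>u 0\<close>.\<close>

lemma harmonic_mean_value_ball:
  fixes u :: "real^'n \<Rightarrow> real"
  assumes u: "harmonic_on (ball 0 1) u" and r: "0 < r" "r < 1"
  shows "(LINT x:ball 0 r|lborel. u x) = measure lborel (ball (0::real^'n) r) * u 0"
proof -
  have "continuous_on (ball 0 r) u"
    by (rule continuous_on_subset[OF harmonic_onD(4)[OF u]]) (use r in auto)
  then have m: "(\<lambda>x. indicator (ball 0 r) x *\<^sub>R u x) \<in> borel_measurable borel"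
    by (intro borel_measurable_continuous_on_indicator) auto
  have "(LINT x:ball 0 r|lborel. u x)
      = r ^ DIM(real^'n) * (\<integral>x. indicator (ball 0 r) (r *\<^sub>R x) *\<^sub>R u (r *\<^sub>R x) \<partial>lborel)"
    unfolding set_lebesgue_integral_def by (rule integral_lborel_scaleR[OF m r(1)])
  also have "(\<integral>x. indicator (ball 0 r) (r *\<^sub>R x) *\<^sub>R u (r *\<^sub>R x) \<partial>lborel)
      = (LINT x:ball 0 1|lborel. u (r *\<^sub>R x) * 1)"
    unfolding set_lebesgue_integral_def using r
    by (intro Bochner_Integration.integral_cong) (auto simp: indicator_def)
  also have "(LINT x:ball 0 1|lborel. u (r *\<^sub>R x) * 1)
      = (LINT x:ball 0 1|lborel. u ((0::real) *\<^sub>R x) * 1)"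
    by (rule harmonic_dilation_product_integral[OF u harmonic_on_const,
          where l = "-1" and m = 1 and A = "\<lambda>s. s" and B = "\<lambda>_. 0" and A' = "\<lambda>_. 1" and B' = "\<lambda>_. 0"])
      (use r in auto)
  also have "\<dots> = measure lborel (ball (0::real^'n) 1) * u 0"
  proof -
    have "emeasure lborel (ball (0::real^'n) 1) \<noteq> \<infinity>"
      using emeasure_bounded_finite[OF bounded_ball, of "0::real^'n" 1] by (metis order_less_irrefl)
    from set_integral_const[OF _ this, of "u 0"] show ?thesis by simp
  qed
  finally show ?thesis
    using content_ball_conv_unit_ball[of r "0::real^'n"] r by simp
qed

text \<open>The shift by two makes all radii positive: the first one is \<open>1/2\<close>.\<close>

definition inner_radius :: "nat \<Rightarrow> real"
  where "inner_radius i = 1 - inverse (real (Suc (Suc i)))"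

lemma inner_radius_bounds: "0 < inner_radius i" "inner_radius i < 1"
  by (auto simp: inner_radius_def field_simps)

lemma mono_inner_radius: "i \<le> j \<Longrightarrow> inner_radius i \<le> inner_radius j"
  by (auto simp: inner_radius_def field_simps)

lemma inner_radius_tendsto: "inner_radius \<longlonglongrightarrow> 1"
  using tendsto_diff[OF tendsto_const LIMSEQ_Suc[OF LIMSEQ_inverse_real_of_nat], of 1]
  unfolding inner_radius_def by simp

lemma UN_ball_inner_radius: "(\<Union>i. ball (0::real^'n) (inner_radius i)) = ball 0 1"
proof safe
  fix x :: "real^'n" assume "x \<in> ball 0 1"
  then have "\<forall>\<^sub>F i in sequentially. norm x < inner_radius i"
    using order_tendstoD(1)[OF inner_radius_tendsto] by simp
  then show "x \<in> (\<Union>i. ball 0 (inner_radius i))"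
    by (auto simp: eventually_sequentially)
qed (use inner_radius_bounds(2) in \<open>auto intro: less_trans\<close>)

lemma content_ball_inner_radius_tendsto:
  "(\<lambda>i. measure lborel (ball (0::real^'n) (inner_radius i))) \<longlonglongrightarrow> measure lborel (ball (0::real^'n) 1)"
proof -
  have "(\<lambda>i. inner_radius i ^ DIM(real^'n) * measure lborel (ball (0::real^'n) 1))
      \<longlonglongrightarrow> 1 ^ DIM(real^'n) * measure lborel (ball (0::real^'n) 1)"
    by (intro tendsto_intros inner_radius_tendsto)
  moreover have "measure lborel (ball (0::real^'n) (inner_radius i))
      = inner_radius i ^ DIM(real^'n) * measure lborel (ball (0::real^'n) 1)" for i
    by (rule content_ball_conv_unit_ball) (use inner_radius_bounds(1)[of i] in simp)
  ultimately show ?thesis by (simp only: power_one mult_1_left)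
qed

lemma set_integrable_harmonic_inner:
  assumes u: "harmonic_on (ball 0 1) u" and r: "r < 1"
  shows "set_integrable lborel (ball 0 r) u"
  by (rule set_integrable_ball_if_continuous_on_cball, rule continuous_on_subset[OF harmonic_onD(4)[OF u]])
    (use r in auto)

text \<open>By the mean value property the integrals over the inner balls are their volumes times
  \<open>u 0\<close>, hence bounded, and monotone convergence applies. This gives integrability of
  the function with a pole without any estimate near the pole.\<close>

lemma nonneg_harmonic_integrable:
  fixes u :: "real^'n \<Rightarrow> real"
  assumes u: "harmonic_on (ball 0 1) u" and pos: "\<And>x. x \<in> ball 0 1 \<Longrightarrow> u x \<ge> 0"
  shows "set_integrable lborel (ball 0 1) u"
  unfolding set_integrable_def
proof (rule integral_monotone_convergence_nonneg(1))
  let ?f = "\<lambda>i x. indicator (ball (0::real^'n) (inner_radius i)) x *\<^sub>R u x"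
  show "integrable lborel (?f i)" for i
    using set_integrable_harmonic_inner[OF u inner_radius_bounds(2)]
    by (simp add: set_integrable_def)
  have sub: "x \<in> ball 0 1" if "norm x < inner_radius i" for x :: "real^'n" and i
    using that inner_radius_bounds(2)[of i] by simp
  show "AE x in lborel. mono (\<lambda>i. ?f i x)"
    using mono_inner_radius pos sub
    by (intro AE_I2 monoI) (force simp: indicator_def)
  show "AE x in lborel. 0 \<le> ?f i x" for i
    using pos sub by (intro AE_I2) (auto simp: indicator_def)
  show "AE x in lborel. (\<lambda>i. ?f i x) \<longlonglongrightarrow> indicator (ball 0 1) x *\<^sub>R u x"
  proof (intro AE_I2 tendsto_eventually)
    fix x :: "real^'n"
    show "\<forall>\<^sub>F i in sequentially. ?f i x = indicator (ball 0 1) x *\<^sub>R u x"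
    proof (cases "x \<in> ball 0 1")
      case True
      then have "\<forall>\<^sub>F i in sequentially. norm x < inner_radius i"
        using order_tendstoD(1)[OF inner_radius_tendsto] by simp
      then show ?thesis by eventually_elim (use True in simp)
    next
      case False
      then have "\<not> norm x < inner_radius i" for i using sub by blast
      then show ?thesis using False by simp
    qed
  qed
  show "(\<lambda>i. \<integral>x. ?f i x \<partial>lborel) \<longlonglongrightarrow> measure lborel (ball (0::real^'n) 1) * u 0"
    using harmonic_mean_value_ball[OF u inner_radius_bounds]
      tendsto_mult_right[OF content_ball_inner_radius_tendsto, of "u 0"]
    by (simp add: set_lebesgue_integral_def)
  show "(\<lambda>x. indicator (ball 0 1) x *\<^sub>R u x) \<in> borel_measurable lborel"
    unfolding measurable_lborel2
    by (rule borel_measurable_continuous_on_indicator[OF _ harmonic_onD(4)[OF u]]) simp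
qed

text \<open>Here \<open>u\<close> is only integrable and may be unbounded near the sphere, so the
  dilation argument is applied to the inner balls and followed by a limit.\<close>

lemma harmonic_mean_value_unit_ball:
  fixes u :: "real^'n \<Rightarrow> real"
  assumes u: "harmonic_on (ball 0 1) u" and int: "set_integrable lborel (ball 0 1) u"
  shows "(LINT x:ball 0 1|lborel. u x) = measure lborel (ball (0::real^'n) 1) * u 0"
proof (rule LIMSEQ_unique)
  show "(\<lambda>i. LINT x:ball 0 (inner_radius i)|lborel. u x) \<longlonglongrightarrow> (LINT x:ball 0 1|lborel. u x)"
    unfolding UN_ball_inner_radius[symmetric]
    by (rule set_integral_cont_up)
      (use int UN_ball_inner_radius[where 'n = 'n] mono_inner_radius in
        \<open>auto simp: incseq_def intro: less_le_trans[OF _ mono_inner_radius]\<close>)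
  show "(\<lambda>i. LINT x:ball 0 (inner_radius i)|lborel. u x) \<longlonglongrightarrow> measure lborel (ball (0::real^'n) 1) * u 0"
    using harmonic_mean_value_ball[OF u inner_radius_bounds]
      tendsto_mult_right[OF content_ball_inner_radius_tendsto, of "u 0"] by simp
qed

text \<open>An energy argument: the field \<open>u grad u\<close> vanishes on the sphere and has
  divergence \<open>|grad u|^2\<close>, because \<open>u\<close> is harmonic. Thus the gradient is
  zero in the ball, and \<open>u\<close> equals its boundary value.\<close>

lemma harmonic_eq_0_ball_if_eq_0_sphere:
  fixes u :: "real^'n \<Rightarrow> real"
  assumes u: "harmonic_on (ball 0 1) u" and r: "0 < r" "r < 1"
    and z: "\<And>x. norm x = r \<Longrightarrow> u x = 0" and x: "norm x \<le> r"
  shows "u x = 0"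
proof -
  let ?D = "\<lambda>i. dir_deriv (axis i 1) :: (real^'n \<Rightarrow> real) \<Rightarrow> real^'n \<Rightarrow> real"
  have sub: "cball (0::real^'n) r \<subseteq> ball 0 1" "ball (0::real^'n) r \<subseteq> ball 0 1"
    using r by auto
  have 1: "Ck_on 1 (ball 0 1) (\<lambda>x. u x * ?D i u x)" for i
    by (intro Ck_on_mult open_ball harmonic_onD(2,3)[OF u])
  have 0: "(LINT x:ball 0 r|lborel. ?D i (\<lambda>x. u x * ?D i u x) x) = 0" for i
    by (rule set_integral_dir_deriv_eq_0[OF open_ball sub(1) r(1) 1]) (simp add: z)
  have int: "set_integrable lborel (ball 0 r) (?D i (\<lambda>x. u x * ?D i u x))" for i
    by (rule set_integrable_ball_if_continuous_on_cball, rule continuous_on_subset[OF _ sub(1)])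
      (use 1[of i] in simp)
  have eq: "(\<Sum>i\<in>UNIV. ?D i (\<lambda>x. u x * ?D i u x) x) = (\<Sum>i\<in>UNIV. (?D i u x)\<^sup>2)"
    if x: "x \<in> ball 0 1" for x
    using harmonic_onD(8)[OF u x]
    by (simp add: dir_deriv_mult harmonic_onD(6,7)[OF u x] sum.distrib sum_distrib_left[symmetric]
        power2_eq_square)
  have "(LINT x:ball 0 r|lborel. \<Sum>i\<in>UNIV. (?D i u x)\<^sup>2)
      = (LINT x:ball 0 r|lborel. \<Sum>i\<in>UNIV. ?D i (\<lambda>x. u x * ?D i u x) x)"
    using eq sub(2) by (intro set_lebesgue_integral_cong) (auto simp del: mem_ball)
  also have "\<dots> = 0"
    using int 0 by (simp add: set_lebesgue_integral_sum)
  finally have grad0: "(LINT x:ball 0 r|lborel. \<Sum>i\<in>UNIV. (?D i u x)\<^sup>2) = 0" .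
  have "(\<Sum>i\<in>UNIV. (?D i u x)\<^sup>2) = 0" if "x \<in> ball 0 r" for x
  proof (rule set_integral_eq_0_imp_eq_0[OF open_ball _ _ _ grad0 that])
    have c: "continuous_on (cball 0 r) (\<lambda>x. \<Sum>i\<in>UNIV. (?D i u x)\<^sup>2)"
      by (intro continuous_intros continuous_on_subset[OF harmonic_onD(5)[OF u] sub(1)])
    then show "continuous_on (ball 0 r) (\<lambda>x. \<Sum>i\<in>UNIV. (?D i u x)\<^sup>2)"
      by (rule continuous_on_subset) auto
    show "set_integrable lborel (ball 0 r) (\<lambda>x. \<Sum>i\<in>UNIV. (?D i u x)\<^sup>2)"
      by (rule set_integrable_ball_if_continuous_on_cball[OF c])
  qed (simp add: sum_nonneg)
  then have D0: "?D i u x = 0" if "x \<in> ball 0 r" for x i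
    using that by (simp add: sum_nonneg_eq_0_iff)
  have "(u has_derivative (\<lambda>h. 0)) (at x within ball 0 r)" if "x \<in> ball 0 r" for x
  proof -
    have d: "u differentiable (at x)" using harmonic_onD(6)[OF u] that sub by blast
    have "(\<lambda>v. dir_deriv v u x) = (\<lambda>v. 0)"
      using dir_deriv_axis_sum[OF d] D0[OF that] by auto
    then show ?thesis
      using has_derivative_at_withinI[OF has_derivative_dir_deriv[OF d]] by metis
  qed
  from has_derivative_zero_constant[OF convex_ball this]
  obtain c where c: "\<And>x. x \<in> ball 0 r \<Longrightarrow> u x = c" by blast
  have const: "u x = c" if "norm x \<le> r" for x
  proof (rule continuous_constant_on_closure[of "ball 0 r" u c x])
    show "continuous_on (closure (ball 0 r)) u"
      using continuous_on_subset[OF harmonic_onD(4)[OF u] sub(1)] r by simp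
    show "x \<in> closure (ball 0 r)"
      using that r by simp
  qed (use c in auto)
  obtain e :: "real^'n" where "norm e = r"
    using vector_choose_size[of r] r by auto
  with const[of e] z[of e] have "c = 0" by simp
  with const[OF x] show ?thesis by simp
qed

text \<open>The dilation identity with \<open>u = v\<close> equates the factors
  \<open>(r, r)\<close> with any pair of the same product. The integral of \<open>u (r x)^2\<close>
  therefore equals that of \<open>u (s x) u ((r^2 / s) x)\<close>, and the latter vanishes when
  \<open>s\<close> lies in the range where \<open>u\<close> is known to be zero.\<close>

lemma harmonic_unique_continuation_step:
  fixes u :: "real^'n \<Rightarrow> real"
  assumes u: "harmonic_on (ball 0 1) u" and r: "0 < r" "r < 1" "r\<^sup>2 < q"
    and z: "\<And>x. norm x < q \<Longrightarrow> u x = 0" and x: "norm x < r"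
  shows "u x = 0"
proof -
  \<comment> \<open>The midpoint of the admissible interval: \<open>s < q\<close> makes
    \<open>u (s x)\<close> vanish on the unit ball, while \<open>r^2 < s < 1\<close> keeps both
    factors \<open>s\<close> and \<open>r^2 / s\<close> below 1.\<close>
  define s where "s = (r\<^sup>2 + min q 1) / 2"
  have r2: "0 < r\<^sup>2" "r\<^sup>2 < r" using r by (auto simp: power2_eq_square)
  have s: "r\<^sup>2 < s" "s < 1" "s < q"
    using r r2 by (auto simp: s_def min_def)
  then have s0: "0 < s" using r2 by linarith
  have small: "r *\<^sub>R x \<in> ball 0 1" if "x \<in> cball 0 1" for x :: "real^'n"
  proof -
    have "r * norm x \<le> r" by (rule mult_left_le) (use that r in auto)
    then have "r * norm x < 1" using r(2) by (rule le_less_trans)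
    then show ?thesis using r by simp
  qed
  have "(LINT x:ball 0 1|lborel. u (r *\<^sub>R x) * u ((r\<^sup>2 / r) *\<^sub>R x))
      = (LINT x:ball 0 1|lborel. u (s *\<^sub>R x) * u ((r\<^sup>2 / s) *\<^sub>R x))"
    by (rule harmonic_dilation_product_integral[OF u u, where l = "r\<^sup>2" and m = 1 and A = "\<lambda>s. s"
          and B = "\<lambda>s. r\<^sup>2 / s" and A' = "\<lambda>_. 1" and B' = "\<lambda>s. - r\<^sup>2 / s\<^sup>2"])
      (use r r2 s s0 in \<open>auto intro!: derivative_eq_intros continuous_intros simp: power2_eq_square\<close>)
  also have "\<dots> = (LINT x:ball (0::real^'n) 1|lborel. 0)"
  proof (rule set_lebesgue_integral_cong; (intro allI impI)?)
    fix x :: "real^'n" assume "x \<in> ball 0 1"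
    then have "s * norm x \<le> s" using s0 by (intro mult_left_le) auto
    then have "s * norm x < q" using s(3) by (rule le_less_trans)
    then have "norm (s *\<^sub>R x) < q" using s0 by simp
    then show "u (s *\<^sub>R x) * u ((r\<^sup>2 / s) *\<^sub>R x) = 0" using z by simp
  qed simp
  finally have 0: "(LINT x:ball 0 1|lborel. u (r *\<^sub>R x) * u (r *\<^sub>R x)) = 0"
    using r by (simp add: power2_eq_square)
  have cont: "continuous_on (cball 0 1) (\<lambda>x. u (r *\<^sub>R x) * u (r *\<^sub>R x))"
    by (intro continuous_on_mult continuous_on_compose2[OF harmonic_onD(4)[OF u]] continuous_intros)
      (use small in auto)
  have "u (r *\<^sub>R y) * u (r *\<^sub>R y) = 0" if "y \<in> ball 0 1" for y
    by (rule set_integral_eq_0_imp_eq_0[OF open_ball _ _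
          set_integrable_ball_if_continuous_on_cball[OF cont] 0 that])
      (auto intro: continuous_on_subset[OF cont])
  from this[of "(1 / r) *\<^sub>R x"] show ?thesis using x r by (simp add: field_simps)
qed

text \<open>The step enlarges a zero ball of radius \<open>q\<close> to every radius below
  \<open>1\<close> and below the square root of \<open>q\<close>. The supremum of the admissible
  radii thus cannot lie strictly between 0 and 1, where the square root exceeds the number.\<close>

lemma harmonic_unique_continuation:
  fixes u :: "real^'n \<Rightarrow> real"
  assumes u: "harmonic_on (ball 0 1) u" and r: "0 < r"
    and z: "\<And>x. norm x < r \<Longrightarrow> u x = 0" and x: "norm x < 1"
  shows "u x = 0"
proof -
  define T where "T = {t. 0 < t \<and> t \<le> 1 \<and> (\<forall>x. norm x < t \<longrightarrow> u x = 0)}"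
  have T: "min r 1 \<in> T" using r z by (auto simp: T_def)
  have bdd: "bdd_above T" by (auto simp: T_def intro: bdd_aboveI[of _ 1])
  have Sup: "0 < Sup T" "Sup T \<le> 1"
  proof -
    have "min r 1 \<le> Sup T" by (rule cSup_upper[OF T bdd])
    then show "0 < Sup T" using r by (simp add: min_def split: if_splits)
    show "Sup T \<le> 1"
    proof (rule cSup_least)
      show "T \<noteq> {}" using T by blast
    qed (simp add: T_def)
  qed
  have "Sup T = 1"
  proof (rule ccontr)
    assume "Sup T \<noteq> 1"
    with Sup have S1: "Sup T < 1" by simp
    have "Sup T < sqrt (Sup T)" "sqrt (Sup T) < 1"
      using Sup(1) S1 by (auto simp: real_less_rsqrt power2_eq_square)
    then obtain t where t: "Sup T < t" "t < sqrt (Sup T)" "t < 1"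
      using dense by (meson less_trans)
    have "t\<^sup>2 < (sqrt (Sup T))\<^sup>2"
      using t Sup(1) by (intro power_strict_mono) auto
    then have "t\<^sup>2 < Sup T" using Sup(1) by simp
    then obtain q where q: "q \<in> T" "t\<^sup>2 < q"
      using less_cSup_iff[OF _ bdd] T by blast
    have "t \<in> T"
      using harmonic_unique_continuation_step[OF u _ t(3) q(2)] q(1) t Sup(1)
      by (auto simp: T_def)
    then show False using cSup_upper[OF _ bdd, of t] t(1) by simp
  qed
  then obtain q where "q \<in> T" "norm x < q"
    using less_cSup_iff[OF _ bdd] T x by (metis empty_iff)
  then show ?thesis by (simp add: T_def)
qed

section \<open>Best harmonic approximation in \<open>L\<^sup>1\<close>\<close>

text \<open>The function is the real part of \<open>1 / (1 - z)\<close> for \<open>z\<close> with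
  real part \<open>x $ i\<close> and imaginary part \<open>x $ j\<close>, and constant in the other
  coordinates. It is positive on the half space, and within the closed unit ball its only
  singularity is \<open>axis i 1\<close>. Being rational, it lets harmonicity be checked by direct
  calculation in every dimension.\<close>

lemma harmonic_plane_pole:
  fixes i j :: "'n::finite"
  assumes ij: "i \<noteq> j"
  shows "harmonic_on {x::real^'n. x $ i < 1}
    (\<lambda>x. (1 - x $ i) * inverse ((1 - x $ i) * (1 - x $ i) + x $ j * x $ j))"
proof -
  define S where "S = {x::real^'n. x $ i < 1}"
  define a b Q :: "real^'n \<Rightarrow> real"
    where "a = (\<lambda>x. 1 - x $ i)" and "b = (\<lambda>x. x $ j)"
      and "Q = (\<lambda>x. inverse (a x * a x + b x * b x))"
  have S: "open S"
    unfolding S_def by (intro open_Collect_less continuous_intros)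
  have nz: "a x * a x + b x * b x \<noteq> 0" if "x \<in> S" for x
    using that by (auto simp: S_def a_def b_def sum_squares_eq_zero_iff)
  have Ca: "Ck_on k S a" and Cb: "Ck_on k S b" for k
    unfolding a_def b_def by (intro Ck_on_diff Ck_on_const Ck_on_vec_nth S)+
  have CQ: "Ck_on k S Q" for k
    unfolding Q_def by (intro Ck_on_inverse Ck_on_add Ck_on_mult Ca Cb S nz)
  have d: "a differentiable (at x)" "b differentiable (at x)" "Q differentiable (at x)"
    if "x \<in> S" for x
    using Ca[of 1] Cb[of 1] CQ[of 1] that by auto
  have da: "dir_deriv v a x = - v $ i" and db: "dir_deriv v b x = v $ j" for v x
    unfolding a_def b_def
    by (simp_all add: dir_deriv_diff bounded_linear_imp_differentiable[OF bounded_linear_vec_nth])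
  have dQ: "dir_deriv v Q x = 2 * (a x * v $ i - b x * v $ j) * (Q x * Q x)" if x: "x \<in> S" for v x
  proof -
    have q: "dir_deriv v (\<lambda>x. a x * a x + b x * b x) x = - 2 * (a x * v $ i - b x * v $ j)"
      by (simp add: dir_deriv_add dir_deriv_mult differentiable_mult d[OF x] da db)
    have "dir_deriv v Q x = - (Q x * dir_deriv v (\<lambda>x. a x * a x + b x * b x) x * Q x)"
      unfolding Q_def
      by (rule dir_deriv_inverse) (intro differentiable_add differentiable_mult d[OF x] nz[OF x])+
    then show ?thesis unfolding q by (simp add: algebra_simps)
  qed
  define F where "F = (\<lambda>v x. a x * (2 * (a x * v $ i - b x * v $ j) * (Q x * Q x)) - v $ i * Q x)"
  have D1: "dir_deriv v (\<lambda>x. a x * Q x) x = F v x" if x: "x \<in> S" for v x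
    by (simp add: F_def dir_deriv_mult d[OF x] da dQ[OF x])
  have dF: "F v differentiable (at x)" if x: "x \<in> S" for v x
    unfolding F_def by (intro differentiable_diff differentiable_mult d[OF x] differentiable_const)
  have D2: "dir_deriv v (F v) x =
      a x * (2 * (a x * v $ i - b x * v $ j) * (4 * (a x * v $ i - b x * v $ j) * (Q x * Q x * Q x)))
    - a x * (2 * (v $ i * v $ i + v $ j * v $ j) * (Q x * Q x))
    - v $ i * (4 * (a x * v $ i - b x * v $ j) * (Q x * Q x))" if x: "x \<in> S" for v x
    unfolding F_def
    by (simp add: dir_deriv_mult dir_deriv_diff differentiable_mult differentiable_diff
        d[OF x] da db dQ[OF x]) (simp add: algebra_simps)
  have "harmonic_on S (\<lambda>x. a x * Q x)"
    unfolding harmonic_on_def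
  proof (intro conjI ballI Ck_on_mult S Ca CQ)
    fix x assume x: "x \<in> S"
    let ?T = "\<lambda>k. dir_deriv (axis k 1) (dir_deriv (axis k 1) (\<lambda>x. a x * Q x)) x"
    have T: "?T k = dir_deriv (axis k 1) (F (axis k 1)) x" for k
      by (rule dir_deriv_cong[OF S x, symmetric]) (use D1 dF x in auto)
    \<comment> \<open>Every term of \<open>D2\<close> has a factor linear or quadratic in
      \<open>v $ i\<close> and \<open>v $ j\<close>, so the other coordinate directions contribute
      nothing.\<close>
    have "laplacian (\<lambda>x. a x * Q x) x = (\<Sum>k\<in>{i, j}. ?T k)"
      unfolding laplacian_def T
      by (rule sum.mono_neutral_right) (auto simp: D2[OF x] axis_def)
    also have "\<dots> = 8 * a x * (Q x * Q x) * (Q x * (a x * a x + b x * b x) - 1)"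
      using ij unfolding T by (simp add: D2[OF x] axis_def algebra_simps)
    also have "Q x * (a x * a x + b x * b x) = 1"
      using nz[OF x] by (simp add: Q_def)
    finally show "laplacian (\<lambda>x. a x * Q x) x = 0" by simp
  qed
  then show ?thesis by (simp add: S_def a_def b_def Q_def)
qed

lemma harmonic_on_subset: "harmonic_on S u \<Longrightarrow> T \<subseteq> S \<Longrightarrow> harmonic_on T u"
  by (auto simp: harmonic_on_def intro: Ck_on_subset)

text \<open>The notions of the theorem are stated over \<open>lebesgue\<close>, the analysis over
  \<open>lborel\<close>. For functions continuous on the ball, hence Borel there, the two
  agree.\<close>

lemma integrable_ball_lebesgue_iff:
  fixes f :: "real^'n \<Rightarrow> real"
  assumes "continuous_on (ball 0 1) f"
  shows "f absolutely_integrable_on ball 0 1 \<longleftrightarrow> set_integrable lborel (ball 0 1) f"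
  using borel_measurable_continuous_on_indicator[OF _ assms]
  unfolding set_integrable_def by (intro integrable_completion) simp

lemma L1h_ball_iff:
  "h \<in> L1h_ball \<longleftrightarrow> harmonic_on (ball 0 1) h \<and> set_integrable lborel (ball 0 1) h"
  using integrable_ball_lebesgue_iff[OF harmonic_onD(4)] by (auto simp: L1h_ball_def)

lemma L1_norm_ball_eq:
  fixes f :: "real^'n \<Rightarrow> real"
  assumes "continuous_on (ball 0 1) f"
  shows "L1_norm_ball f = (LINT x:ball 0 1|lborel. \<bar>f x\<bar>)"
  using borel_measurable_continuous_on_indicator[OF _ continuous_on_rabs[OF assms]]
  unfolding L1_norm_ball_def set_lebesgue_integral_def by (intro integral_completion) simp

section \<open>Duality with the sign function\<close>

context
  fixes \<rho> :: real and s :: "real^'n \<Rightarrow> real"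
  assumes \<rho>: "0 < \<rho>" "\<rho> < 1" "2 * \<rho> ^ CARD('n) = 1"
  defines "s \<equiv> \<lambda>x. if norm x < \<rho> then 1 else - 1"
begin

lemma indicator_sign_eq:
  "indicator (ball 0 1) x *\<^sub>R (s x * f x)
    = 2 * (indicator (ball 0 \<rho>) x *\<^sub>R f x) - indicator (ball 0 1) x *\<^sub>R f x"
  using \<rho> by (auto simp: s_def indicator_def)

lemma set_integrable_sign:
  assumes "set_integrable lborel (ball 0 1) f"
  shows "set_integrable lborel (ball 0 1) (\<lambda>x. s x * f x)"
proof -
  have "set_integrable lborel (ball 0 \<rho>) f"
    by (rule set_integrable_subset[OF assms]) (use \<rho> in auto)
  with assms show ?thesis
    unfolding set_integrable_def indicator_sign_eq
    by (intro Bochner_Integration.integrable_diff integrable_mult_right)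
qed

text \<open>The ball of radius \<open>\<rho>\<close> has half the volume of the unit ball.\<close>

lemma set_integral_sign_harmonic:
  assumes g: "harmonic_on (ball 0 1) g" and int: "set_integrable lborel (ball 0 1) g"
  shows "(LINT x:ball 0 1|lborel. s x * g x) = 0"
proof -
  have int': "set_integrable lborel (ball 0 \<rho>) g"
    by (rule set_integrable_subset[OF int]) (use \<rho> in auto)
  have "(LINT x:ball 0 1|lborel. s x * g x)
      = 2 * (LINT x:ball 0 \<rho>|lborel. g x) - (LINT x:ball 0 1|lborel. g x)"
    using int int' unfolding set_lebesgue_integral_def set_integrable_def indicator_sign_eq
    by simp
  also have "\<dots> = (2 * measure lborel (ball (0::real^'n) \<rho>) - measure lborel (ball (0::real^'n) 1)) * g 0"
    by (simp add: harmonic_mean_value_ball[OF g \<rho>(1,2)] harmonic_mean_value_unit_ball[OF g int]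
        left_diff_distrib)
  also have "measure lborel (ball (0::real^'n) \<rho>) = \<rho> ^ CARD('n) * measure lborel (ball (0::real^'n) 1)"
    using content_ball_conv_unit_ball[of \<rho> "0::real^'n"] \<rho> by simp
  finally show ?thesis
    using \<rho>(3) by (simp add: mult.assoc[symmetric] del: mult_eq_0_iff)
qed

text \<open>A point of the sphere is a limit of points inside and of points outside, so either
  strict sign at the point would spread to a side where it is excluded.\<close>

lemma eq_0_on_sphere_if_sign_change:
  fixes w :: "real^'n \<Rightarrow> real"
  assumes w: "continuous_on (ball 0 1) w"
    and inner: "\<And>x. norm x < \<rho> \<Longrightarrow> 0 \<le> w x"
    and outer: "\<And>x. \<rho> < norm x \<Longrightarrow> norm x < 1 \<Longrightarrow> w x \<le> 0"
    and x: "norm x = \<rho>"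
  shows "w x = 0"
proof (rule ccontr)
  assume "w x \<noteq> 0"
  then consider "w x < 0" | "w x > 0" by linarith
  then show False
  proof cases
    case 1
    define N where "N = ball 0 1 \<inter> w -` {..<0}"
    have "open N" unfolding N_def by (rule continuous_open_preimage[OF w]) auto
    moreover have "x \<in> closure (ball 0 \<rho>)" using x \<rho> by simp
    moreover have "x \<in> N" using x \<rho> 1 by (simp add: N_def)
    ultimately obtain y where "y \<in> N" "y \<in> ball 0 \<rho>"
      using open_Int_closure_eq_empty[of N "ball 0 \<rho>"] by blast
    then show False using inner[of y] by (simp add: N_def)
  next
    case 2
    define N where "N = ball 0 1 \<inter> w -` {0<..}"
    have "open N" unfolding N_def by (rule continuous_open_preimage[OF w]) auto
    moreover have "x \<in> closure (- cball 0 \<rho>)" using x by (simp add: closure_complement)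
    moreover have "x \<in> N" using x \<rho> 2 by (simp add: N_def)
    ultimately obtain y where "y \<in> N" "y \<in> - cball 0 \<rho>"
      using open_Int_closure_eq_empty[of N "- cball 0 \<rho>"] by blast
    then show False using outer[of y] by (simp add: N_def)
  qed
qed

text \<open>The difference \<open>\<bar>w x\<bar> - s x * w x\<close> is nonnegative and its
  integral is at most zero, so it vanishes wherever it is continuous.\<close>

lemma sign_pattern_if_L1_norm_le:
  fixes w :: "real^'n \<Rightarrow> real"
  assumes w: "continuous_on (ball 0 1) w" and int: "set_integrable lborel (ball 0 1) w"
    and le: "(LINT x:ball 0 1|lborel. \<bar>w x\<bar>) \<le> (LINT x:ball 0 1|lborel. s x * w x)"
  shows "norm x < \<rho> \<Longrightarrow> 0 \<le> w x" and "\<rho> < norm x \<Longrightarrow> norm x < 1 \<Longrightarrow> w x \<le> 0"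
proof -
  let ?f = "\<lambda>x. \<bar>w x\<bar> - s x * w x"
  have f0: "0 \<le> ?f x" for x by (auto simp: s_def)
  have fint: "set_integrable lborel (ball 0 1) ?f"
    by (intro set_integral_diff set_integrable_abs int set_integrable_sign)
  have fle: "(LINT x:ball 0 1|lborel. ?f x) \<le> 0"
    using le by (simp add: set_integral_diff set_integrable_abs int set_integrable_sign)
  \<comment> \<open>Since \<open>s\<close> jumps at radius \<open>\<rho>\<close>, the vanishing
    argument is run separately on open sets \<open>T\<close> where \<open>s\<close> is constant,
    namely the inner ball and the outer shell.\<close>
  have sub: "?f y = 0"
    if T: "open T" "T \<subseteq> ball 0 1" "continuous_on T ?f" "y \<in> T" for T y
  proof (rule set_integral_eq_0_imp_eq_0[OF T(1,3) f0 _ _ T(4)])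
    show Tint: "set_integrable lborel T ?f"
      by (rule set_integrable_subset[OF fint]) (use T in auto)
    have "(LINT x:T|lborel. ?f x) \<le> (LINT x:ball 0 1|lborel. ?f x)"
      using Tint fint T(2) f0 unfolding set_integrable_def set_lebesgue_integral_def
      by (intro integral_mono) (auto simp: indicator_def)
    moreover have "0 \<le> (LINT x:T|lborel. ?f x)"
      using f0 unfolding set_lebesgue_integral_def by (intro integral_nonneg_AE AE_I2) simp
    ultimately show "(LINT x:T|lborel. ?f x) = 0" using fle by linarith
  qed
  show "0 \<le> w x" if x: "norm x < \<rho>"
  proof -
    have "?f x = 0"
    proof (rule sub[of "ball 0 \<rho>"])
      have "continuous_on (ball 0 \<rho>) (\<lambda>x. \<bar>w x\<bar> - w x)"
        by (intro continuous_intros continuous_on_subset[OF w]) (use \<rho> in auto)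
      then show "continuous_on (ball 0 \<rho>) ?f"
        by (rule continuous_on_eq) (simp add: s_def)
    qed (use x \<rho> in auto)
    then show ?thesis using x by (simp add: s_def)
  qed
  show "w x \<le> 0" if x: "\<rho> < norm x" "norm x < 1"
  proof -
    have "?f x = 0"
    proof (rule sub[of "ball 0 1 - cball 0 \<rho>"])
      have "continuous_on (ball 0 1 - cball 0 \<rho>) (\<lambda>x. \<bar>w x\<bar> + w x)"
        by (intro continuous_intros continuous_on_subset[OF w]) auto
      then show "continuous_on (ball 0 1 - cball 0 \<rho>) ?f"
        by (rule continuous_on_eq) (simp add: s_def)
    qed (use x in auto)
    then show ?thesis using x by (simp add: s_def)
  qed
qed

text \<open>For every \<open>g\<close> in \<open>L1h_ball\<close> the norm of
  \<open>\<omega> - g\<close> is at least the integral of \<open>s (\<omega> - g)\<close>, which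
  equals that of \<open>s \<omega>\<close> because \<open>s\<close> annihilates \<open>g\<close>;
  for \<open>g = h\<close> the sign pattern gives equality. The case \<open>norm x = \<rho>\<close>
  belongs to \<open>outer\<close> because \<open>s\<close> is \<open>-1\<close> there.\<close>

lemma best_harmonic_approximant_if_sign_change:
  fixes \<omega> h h' :: "real^'n \<Rightarrow> real"
  assumes \<omega>: "continuous_on (ball 0 1) \<omega>" "set_integrable lborel (ball 0 1) \<omega>"
    and h: "harmonic_on (ball 0 1) h" "set_integrable lborel (ball 0 1) h"
    and inner: "\<And>x. norm x < \<rho> \<Longrightarrow> h x \<le> \<omega> x"
    and outer: "\<And>x. \<rho> \<le> norm x \<Longrightarrow> norm x < 1 \<Longrightarrow> \<omega> x \<le> h x"
  shows "best_harmonic_approximant \<omega> h"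
    and "best_harmonic_approximant \<omega> h' \<Longrightarrow> x \<in> ball 0 1 \<Longrightarrow> h' x = h x"
proof -
  have cont: "continuous_on (ball 0 1) (\<lambda>x. \<omega> x - g x)"
    and norm: "L1_norm_ball (\<lambda>x. \<omega> x - g x) = (LINT x:ball 0 1|lborel. \<bar>\<omega> x - g x\<bar>)"
    and int: "set_integrable lborel (ball 0 1) (\<lambda>x. \<omega> x - g x)"
    and sgn: "(LINT x:ball 0 1|lborel. s x * (\<omega> x - g x)) = (LINT x:ball 0 1|lborel. s x * \<omega> x)"
    if "g \<in> L1h_ball" for g
  proof -
    from that have g: "harmonic_on (ball 0 1) g" "set_integrable lborel (ball 0 1) g"
      by (simp_all add: L1h_ball_iff)
    show c: "continuous_on (ball 0 1) (\<lambda>x. \<omega> x - g x)"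
      by (intro continuous_on_diff \<omega>(1) harmonic_onD(4)[OF g(1)])
    show "L1_norm_ball (\<lambda>x. \<omega> x - g x) = (LINT x:ball 0 1|lborel. \<bar>\<omega> x - g x\<bar>)"
      by (rule L1_norm_ball_eq[OF c])
    show "set_integrable lborel (ball 0 1) (\<lambda>x. \<omega> x - g x)"
      by (rule set_integral_diff(1)[OF \<omega>(2) g(2)])
    show "(LINT x:ball 0 1|lborel. s x * (\<omega> x - g x)) = (LINT x:ball 0 1|lborel. s x * \<omega> x)"
      using set_integral_diff(2)[OF set_integrable_sign[OF \<omega>(2)] set_integrable_sign[OF g(2)]]
      by (simp add: right_diff_distrib set_integral_sign_harmonic[OF g])
  qed
  have hL: "h \<in> L1h_ball" using h by (simp add: L1h_ball_iff)
  have norm_h: "L1_norm_ball (\<lambda>x. \<omega> x - h x) = (LINT x:ball 0 1|lborel. s x * \<omega> x)"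
    unfolding norm[OF hL] sgn[OF hL, symmetric]
    by (rule set_lebesgue_integral_cong) (use inner outer in \<open>auto simp: s_def\<close>)
  have "L1_norm_ball (\<lambda>x. \<omega> x - h x) \<le> L1_norm_ball (\<lambda>x. \<omega> x - g x)" if g: "g \<in> L1h_ball" for g
    unfolding norm_h norm[OF g] sgn[OF g, symmetric]
    by (rule set_integral_mono[OF set_integrable_sign[OF int[OF g]] set_integrable_abs[OF int[OF g]]])
      (auto simp: s_def)
  then show best: "best_harmonic_approximant \<omega> h"
    using \<omega> hL integrable_ball_lebesgue_iff[OF \<omega>(1)] by (simp add: best_harmonic_approximant_def)
  show "h' x = h x" if h': "best_harmonic_approximant \<omega> h'" and x: "x \<in> ball 0 1"
  proof -
    have h'L: "h' \<in> L1h_ball"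
      and "L1_norm_ball (\<lambda>x. \<omega> x - h' x) \<le> L1_norm_ball (\<lambda>x. \<omega> x - h x)"
      using h' hL by (auto simp: best_harmonic_approximant_def)
    \<comment> \<open>The norm of \<open>\<omega> - h'\<close> is at most that of
      \<open>\<omega> - h\<close>, which is the integral of \<open>s \<omega>\<close> and so also
      that of \<open>s (\<omega> - h')\<close>. Another minimizer thus attains equality in the
      duality estimate and must have the sign pattern too.\<close>
    then have le: "(LINT x:ball 0 1|lborel. \<bar>\<omega> x - h' x\<bar>) \<le> (LINT x:ball 0 1|lborel. s x * (\<omega> x - h' x))"
      by (simp add: norm_h norm sgn)
    note sign = sign_pattern_if_L1_norm_le[OF cont[OF h'L] int[OF h'L] le]
    let ?u = "\<lambda>x. h' x - h x"
    have u: "harmonic_on (ball 0 1) ?u"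
      using h'L h(1) by (intro harmonic_on_diff open_ball) (simp_all add: L1h_ball_iff)
    have sphere: "?u y = 0" if y: "norm y = \<rho>" for y
      using eq_0_on_sphere_if_sign_change[OF cont[OF h'L] sign y]
        eq_0_on_sphere_if_sign_change[OF cont[OF hL] _ _ y] inner outer by force
    have inside: "?u y = 0" if "norm y < \<rho>" for y
      using harmonic_eq_0_ball_if_eq_0_sphere[OF u \<rho>(1,2) sphere, of y] that by simp
    show ?thesis
      using harmonic_unique_continuation[OF u \<rho>(1) inside, of x] x by simp
  qed
qed

end


section \<open>The example\<close>

lemma flat_1_strict_mono: "0 < t \<Longrightarrow> s < t \<Longrightarrow> flat 1 s < flat 1 t"
  by (auto simp: flat_def field_simps)

lemma flat_1_mono: "s \<le> t \<Longrightarrow> flat 1 s \<le> flat 1 t"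
  using flat_1_strict_mono[of t s] by (cases "0 < t"; cases "s = t") (auto simp: flat_nonpos)

lemma obtain_two_indices:
  assumes "CARD('n::finite) \<ge> 2"
  obtains i j :: "'n::finite" where "i \<noteq> j"
  using assms card_le_Suc0_iff_eq[of "UNIV :: 'n set"] by fastforce

theorem corollary7p2:
  assumes "CARD('n::finite) \<ge> 2"
  shows "\<exists>(U :: (real^'n) set) V \<omega>.
    open U \<and> cball 0 1 \<subseteq> U \<and> smooth_on U \<omega> \<and>
    open V \<and> sphere 0 1 \<subseteq> V \<and> V \<subseteq> U \<and> real_analytic_on V \<omega> \<and>
    (\<exists>h. best_harmonic_approximant \<omega> h \<and>
         (\<forall>h'. best_harmonic_approximant \<omega> h' \<longrightarrow> (\<forall>x\<in>ball 0 1. h' x = h x)) \<and>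
         \<not> bounded (h ` ball 0 1))"
proof -
  obtain i j :: 'n where ij: "i \<noteq> j" using obtain_two_indices[OF assms] .
  define h :: "real^'n \<Rightarrow> real"
    where "h = (\<lambda>x. (1 - x $ i) * inverse ((1 - x $ i) * (1 - x $ i) + x $ j * x $ j))"
  have lt1: "x $ i < 1" if "x \<in> ball 0 1" for x :: "real^'n"
    using that component_le_norm_cart[of x i] by auto
  have h: "harmonic_on (ball 0 1) h"
    unfolding h_def by (rule harmonic_on_subset[OF harmonic_plane_pole[OF ij]]) (use lt1 in auto)
  have h_pos: "0 < h x" if "x \<in> ball 0 1" for x
    using lt1[OF that] by (auto simp: h_def intro!: mult_pos_pos add_pos_nonneg)
  have h_int: "set_integrable lborel (ball 0 1) h"
    by (rule nonneg_harmonic_integrable[OF h]) (use h_pos in \<open>auto intro: less_imp_le\<close>)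
  have h_Ck: "Ck_on k (ball 0 1) h" for k
    unfolding h_def
    by (intro Ck_on_mult Ck_on_inverse Ck_on_add Ck_on_diff Ck_on_const Ck_on_vec_nth open_ball)
      (use lt1 in \<open>force simp: sum_squares_eq_zero_iff\<close>)
  have h_unbounded: "\<not> bounded (h ` ball 0 1)"
  proof
    assume "bounded (h ` ball 0 1)"
    then obtain M where M: "M > 0" "\<And>x. x \<in> ball 0 1 \<Longrightarrow> \<bar>h x\<bar> \<le> M"
      unfolding bounded_pos by auto
    \<comment> \<open>On the axis towards the pole \<open>h\<close> takes the value
      \<open>1 / (1 - t)\<close>; this \<open>t\<close> makes it \<open>M + 1\<close>.\<close>
    define t where "t = 1 - inverse (M + 1)"
    have t: "0 < t" "t < 1" using M(1) by (auto simp: t_def field_simps)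
    have "h (t *\<^sub>R axis i 1) = (1 - t) * inverse ((1 - t) * (1 - t))"
      using ij by (simp add: h_def axis_def)
    also have "\<dots> = inverse (1 - t)"
      using t by (simp add: inverse_mult_distrib mult.assoc[symmetric])
    also have "\<dots> = M + 1" by (simp add: t_def)
    finally show False using M(2)[of "t *\<^sub>R axis i 1"] M(1) t by simp
  qed
  define \<rho> where "\<rho> = root CARD('n) (1 / 2)"
  have \<rho>: "0 < \<rho>" "\<rho> < 1" "2 * \<rho> ^ CARD('n) = 1"
    using assms by (auto simp: \<rho>_def)
  \<comment> \<open>The squared radius from which the cutoff is zero; any number strictly between
    \<open>\<rho>^2\<close> and 1 would do.\<close>
  define r where "r = (\<rho>\<^sup>2 + 1) / 2"
  have "\<rho>\<^sup>2 < 1" using \<rho> by (simp add: power_less_one_iff abs_square_less_1)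
  then have r: "\<rho>\<^sup>2 < r" "r < 1" by (auto simp: r_def)
  \<comment> \<open>The cutoff of the overview is \<open>c * flat 1 (r - t)\<close> as a function of
    \<open>t\<close>, the squared norm. This \<open>c\<close> normalizes it to 1 at
    \<open>\<rho>^2\<close>, and it decreases because \<open>flat 1\<close> is increasing.\<close>
  define c where "c = inverse (flat 1 (r - \<rho>\<^sup>2))"
  have c: "c > 0" using r by (simp add: c_def flat_def)
  define \<omega> where "\<omega> = (\<lambda>x. c * flat 1 (r - (\<Sum>k\<in>UNIV. x $ k * x $ k)) * h x)"
  define V where "V = {x::real^'n. r < (\<Sum>k\<in>UNIV. x $ k * x $ k)}"
  have V: "open V" unfolding V_def by (intro open_Collect_less continuous_intros)
  have \<omega>V: "\<omega> x = 0" if "x \<in> V" for x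
    using that by (simp add: \<omega>_def V_def flat_nonpos)
  \<comment> \<open>The function \<open>h\<close> is known to be smooth only in the open ball and is
    singular at the pole, but \<open>\<omega>\<close> is identically zero on the open set
    \<open>V\<close>, which contains the pole. As \<open>r < 1\<close>, the ball and
    \<open>V\<close> cover the whole space.\<close>
  have \<omega>_Ck: "Ck_on k UNIV \<omega>" for k
  proof -
    have "Ck_on k (ball 0 1) \<omega>"
      unfolding \<omega>_def
      by (intro Ck_on_mult Ck_on_const Ck_on_flat Ck_on_diff Ck_on_sum_component_squares h_Ck open_ball)
    moreover have "Ck_on k V \<omega>"
      by (rule Ck_on_cong[OF V _ Ck_on_const[of _ _ 0]]) (simp add: \<omega>V)
    ultimately have "Ck_on k (ball 0 1 \<union> V) \<omega>"
      by (rule Ck_on_Un[OF open_ball V])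
    moreover have "x \<in> ball 0 1 \<union> V" for x
    proof (cases "norm x < 1")
      case False
      then have "1 \<le> (norm x)\<^sup>2" by simp
      with r(2) have "r < (norm x)\<^sup>2" by (rule less_le_trans)
      then show ?thesis by (simp add: V_def sum_component_squares)
    qed simp
    then have "ball 0 1 \<union> V = UNIV" by blast
    ultimately show ?thesis by simp
  qed
  have \<omega>_cont: "continuous_on S \<omega>" for S
    using Ck_on_imp_continuous[OF \<omega>_Ck] by (rule continuous_on_subset) simp
  have \<omega>_int: "set_integrable lborel (ball 0 1) \<omega>"
    by (rule set_integrable_ball_if_continuous_on_cball[OF \<omega>_cont])
  have inner: "h x \<le> \<omega> x" if "norm x < \<rho>" for x
  proof -
    have "(norm x)\<^sup>2 \<le> \<rho>\<^sup>2" using that by (intro power_mono) auto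
    then have "inverse c \<le> flat 1 (r - (norm x)\<^sup>2)"
      unfolding c_def inverse_inverse_eq by (intro flat_1_mono) simp
    then have "1 \<le> c * flat 1 (r - (norm x)\<^sup>2)" using c by (simp add: field_simps)
    then show ?thesis
      using h_pos[of x] that \<rho> mult_right_mono[of 1 _ "h x"]
      by (simp add: \<omega>_def sum_component_squares)
  qed
  have outer: "\<omega> x \<le> h x" if "\<rho> \<le> norm x" "norm x < 1" for x
  proof -
    have "\<rho>\<^sup>2 \<le> (norm x)\<^sup>2" using that \<rho> by (intro power_mono) auto
    then have "flat 1 (r - (norm x)\<^sup>2) \<le> inverse c"
      unfolding c_def inverse_inverse_eq by (intro flat_1_mono) simp
    then have "c * flat 1 (r - (norm x)\<^sup>2) \<le> 1" using c by (simp add: field_simps)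
    then show ?thesis
      using h_pos[of x] that mult_right_mono[of _ 1 "h x"]
      by (simp add: \<omega>_def sum_component_squares)
  qed
  note best = best_harmonic_approximant_if_sign_change[OF \<rho> \<omega>_cont \<omega>_int h h_int inner outer]
  have "sphere 0 1 \<subseteq> V" using r by (auto simp: V_def sum_component_squares)
  moreover have "real_analytic_on V \<omega>"
    unfolding real_analytic_on_def
  proof
    fix x assume "x \<in> V"
    with V obtain e where e: "e > 0" "ball x e \<subseteq> V" by (meson open_contains_ball)
    \<comment> \<open>The power series with all coefficients zero suffices, since
      \<open>\<omega>\<close> vanishes on \<open>V\<close>.\<close>
    have "\<forall>y\<in>ball x e. ((\<lambda>\<alpha>. 0 * (\<Prod>i\<in>UNIV. (y $ i - x $ i) ^ \<alpha> i)) has_sum \<omega> y) UNIV"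
      using e(2) \<omega>V by (auto simp: subset_iff)
    with e(1) show "\<exists>e>0. \<exists>a. \<forall>y\<in>ball x e.
        ((\<lambda>\<alpha>. a \<alpha> * (\<Prod>i\<in>UNIV. (y $ i - x $ i) ^ \<alpha> i)) has_sum \<omega> y) UNIV"
      by (intro exI[of _ e] conjI exI[of _ "\<lambda>_. 0"])
  qed
  moreover have "\<exists>h. best_harmonic_approximant \<omega> h \<and>
      (\<forall>h'. best_harmonic_approximant \<omega> h' \<longrightarrow> (\<forall>x\<in>ball 0 1. h' x = h x)) \<and>
      \<not> bounded (h ` ball 0 1)"
    by (intro exI[of _ h] conjI allI impI ballI best h_unbounded)
  moreover have "smooth_on UNIV \<omega>"
    using \<omega>_Ck by (simp add: smooth_on_def)
  ultimately show ?thesis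
    using V
    by - (rule exI[of _ UNIV], rule exI[of _ V], rule exI[of _ \<omega>],
        intro conjI open_UNIV subset_UNIV; assumption)
qed

end
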